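(* Let $X\neq\{0\}$ be a Banach space, let $t_0<t_1$ be real numbers, and let $\alpha,\beta\in[0,\infty)$ satisfy $\alpha<\beta$ together with one of the following conditions: (i) $\alpha\in\mathbb{N}$; or (ii) $\alpha\notin\mathbb{N}$ and $\beta\notin\mathbb{N}$. Then $$RL^{\beta}([t_0,t_1];X)\subsetneq RL^{\alpha}([t_0,t_1];X),$$ and the inclusion is continuous, that is, there exists $M>0$ such that $\|f\|_{RL^{\alpha}([t_0,t_1];X)}\le M\|f\|_{RL^{\beta}([t_0,t_1];X)}$ for every $f\in RL^{\beta}([t_0,t_1];X)$. Moreover, if $0\le\alpha<\beta$ with $\alpha\notin\mathbb{N}$ and $\beta\in\mathbb{N}$, then $RL^{\beta}([t_0,t_1];X)\not\subset RL^{\alpha}([t_0,t_1];X)$.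
   Context: $\mathbb{N}=\{0,1,2,\ldots\}$. $[\alpha]$ denotes the smallest integer greater than or equal to $\alpha$. For $\alpha>0$ the Riemann–Liouville (RL) fractional integral is $J_{t_0,t}^{\alpha}f(t)=\frac{1}{\Gamma(\alpha)}\int_{t_0}^{t}(t-s)^{\alpha-1}f(s)\,ds$ (Bochner integral), and $J_{t_0,t}^{0}f=f$. The RL fractional derivative is $D_{t_0,t}^{\alpha}f(t)=\frac{d^{[\alpha]}}{dt^{[\alpha]}}\big[J_{t_0,t}^{[\alpha]-\alpha}f(t)\big]$, with the derivative taken in the weak sense on $(t_0,t_1)$; for $\alpha\in\mathbb{N}$ it is the $\alpha$-th weak derivative. Writing $D_{t_0,t}^{\alpha}f\in C^0([t_0,t_1];X)$ means that this weak derivative exists and has a continuous representative on $[t_0,t_1]$. For $k\in\mathbb{N}$, $C^{k}([t_0,t_1];X)$ is the space of $k$-times continuously differentiable functions with norm $\sum_{j=0}^k\sup_t\|f^{(j)}(t)\|_X$. For $\alpha>0$, $$RL^{\alpha}([t_0,t_1];X)=\{f\in C^{[\alpha]-1}([t_0,t_1];X): D_{t_0,t}^{\alpha}f\in C^0([t_0,t_1];X)\},$$ with norm $\|f\|_{RL^{\alpha}}=\|f\|_{C^{[\alpha]-1}([t_0,t_1];X)}+\|D_{t_0,t}^{\alpha}f\|_{C^0([t_0,t_1];X)}$; and $RL^0([t_0,t_1];X)=C^0([t_0,t_1];X)$ with the supremum norm. *)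

theory Defs
  imports "HOL-Analysis.Analysis"
begin

section \<open>The Bochner integral in an arbitrary Banach space\<close>

text \<open>
  The library's \<^const>\<open>has_bochner_integral\<close> is restricted to second countable, i.e. separable,
  target spaces. The following is the same definition without that restriction: the existence of
  an approximating sequence of simple functions forces \<open>f\<close> to be strongly measurable.
\<close>

definition has_Bochner :: "'a measure \<Rightarrow> ('a \<Rightarrow> 'b::real_normed_vector) \<Rightarrow> 'b \<Rightarrow> bool" where
  "has_Bochner M f x \<longleftrightarrow>
     f \<in> borel_measurable M \<and>
     (\<exists>s. (\<forall>i. Bochner_Integration.simple_bochner_integrable M (s i)) \<and>
          (\<lambda>i. \<integral>\<^sup>+ y. ennreal (norm (f y - s i y)) \<partial>M) \<longlonglongrightarrow> 0 \<and>
          (\<lambda>i. Bochner_Integration.simple_bochner_integral M (s i)) \<longlonglongrightarrow> x)"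

definition Bochner_integrable :: "'a measure \<Rightarrow> ('a \<Rightarrow> 'b::real_normed_vector) \<Rightarrow> bool" where
  "Bochner_integrable M f \<longleftrightarrow> (\<exists>x. has_Bochner M f x)"

definition Bochner :: "'a measure \<Rightarrow> ('a \<Rightarrow> 'b::real_normed_vector) \<Rightarrow> 'b" where
  "Bochner M f = (if Bochner_integrable M f then THE x. has_Bochner M f x else 0)"

lemma has_Bochner_iff_has_bochner_integral:
  fixes f :: "'a \<Rightarrow> 'b::{real_normed_vector, second_countable_topology}"
  shows "has_Bochner M f x \<longleftrightarrow> has_bochner_integral M f x"
  unfolding has_Bochner_def has_bochner_integral.simps by auto

lemma Bochner_integrable_iff_integrable:
  fixes f :: "'a \<Rightarrow> 'b::{banach, second_countable_topology}"
  shows "Bochner_integrable M f \<longleftrightarrow> integrable M f"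
  by (simp add: Bochner_integrable_def has_Bochner_iff_has_bochner_integral integrable.simps)

lemma Bochner_eq_lebesgue_integral:
  fixes f :: "'a \<Rightarrow> 'b::{banach, second_countable_topology}"
  shows "Bochner M f = integral\<^sup>L M f"
  unfolding Bochner_def Bochner_integrable_def lebesgue_integral_def
    has_Bochner_iff_has_bochner_integral ..


section \<open>Continuously differentiable functions on a compact interval\<close>

text \<open>
  Functions on \<open>[t\<^sub>0, t\<^sub>1]\<close> are total functions of which only the values on \<open>{t0..t1}\<close> matter.
  Derivatives are taken within that interval, hence are one-sided at its end points.
\<close>

primrec higher_deriv_on :: "real set \<Rightarrow> nat \<Rightarrow> (real \<Rightarrow> 'x::real_normed_vector) \<Rightarrow> real \<Rightarrow> 'x" where
  "higher_deriv_on S 0 f = f"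
| "higher_deriv_on S (Suc k) f = (\<lambda>t. vector_derivative (higher_deriv_on S k f) (at t within S))"

definition C_space :: "real \<Rightarrow> real \<Rightarrow> nat \<Rightarrow> (real \<Rightarrow> 'x::real_normed_vector) set" where
  "C_space t0 t1 k = {f.
     (\<forall>j<k. \<forall>t\<in>{t0..t1}. higher_deriv_on {t0..t1} j f differentiable (at t within {t0..t1})) \<and>
     continuous_on {t0..t1} (higher_deriv_on {t0..t1} k f)}"

definition C_norm :: "real \<Rightarrow> real \<Rightarrow> nat \<Rightarrow> (real \<Rightarrow> 'x::real_normed_vector) \<Rightarrow> real" where
  "C_norm t0 t1 k f = (\<Sum>j\<le>k. SUP t\<in>{t0..t1}. norm (higher_deriv_on {t0..t1} j f t))"


section \<open>Weak derivatives\<close>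

definition test_function :: "real \<Rightarrow> real \<Rightarrow> (real \<Rightarrow> real) \<Rightarrow> bool" where
  "test_function a b \<phi> \<longleftrightarrow>
     (\<forall>k t. (deriv ^^ k) \<phi> field_differentiable at t) \<and>
     compact (closure {t. \<phi> t \<noteq> 0}) \<and> closure {t. \<phi> t \<noteq> 0} \<subseteq> {a<..<b}"

definition locally_Bochner_integrable ::
  "real set \<Rightarrow> (real \<Rightarrow> 'x::real_normed_vector) \<Rightarrow> bool" where
  "locally_Bochner_integrable S f \<longleftrightarrow>
     (\<forall>K. compact K \<and> K \<subseteq> S \<longrightarrow> Bochner_integrable (lebesgue_on K) f)"

definition has_weak_derivative ::
  "real \<Rightarrow> real \<Rightarrow> nat \<Rightarrow> (real \<Rightarrow> 'x::real_normed_vector) \<Rightarrow> (real \<Rightarrow> 'x) \<Rightarrow> bool" where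
  "has_weak_derivative a b n u g \<longleftrightarrow>
     locally_Bochner_integrable {a<..<b} u \<and> locally_Bochner_integrable {a<..<b} g \<and>
     (\<forall>\<phi>. test_function a b \<phi> \<longrightarrow>
        Bochner (lebesgue_on {a<..<b}) (\<lambda>t. (deriv ^^ n) \<phi> t *\<^sub>R u t) =
        (-1) ^ n *\<^sub>R Bochner (lebesgue_on {a<..<b}) (\<lambda>t. \<phi> t *\<^sub>R g t))"


section \<open>Riemann--Liouville integrals, derivatives and spaces\<close>

definition RL_integral ::
  "real \<Rightarrow> real \<Rightarrow> (real \<Rightarrow> 'x::real_normed_vector) \<Rightarrow> real \<Rightarrow> 'x" where
  "RL_integral t0 \<alpha> f t =
     (if \<alpha> = 0 then f t
      else (1 / Gamma \<alpha>) *\<^sub>R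
        Bochner (lebesgue_on {t0..t}) (\<lambda>s. ((t - s) powr (\<alpha> - 1)) *\<^sub>R f s))"

definition is_continuous_RL_deriv ::
  "real \<Rightarrow> real \<Rightarrow> real \<Rightarrow> (real \<Rightarrow> 'x::real_normed_vector) \<Rightarrow> (real \<Rightarrow> 'x) \<Rightarrow> bool" where
  "is_continuous_RL_deriv t0 t1 \<alpha> f g \<longleftrightarrow>
     continuous_on {t0..t1} g \<and>
     has_weak_derivative t0 t1 (nat \<lceil>\<alpha>\<rceil>) (RL_integral t0 (of_int \<lceil>\<alpha>\<rceil> - \<alpha>) f) g"

text \<open>
  The continuous representative, if there is one; its values on \<open>{t0..t1}\<close> are then uniquely
  determined.
\<close>

definition RL_deriv ::
  "real \<Rightarrow> real \<Rightarrow> real \<Rightarrow> (real \<Rightarrow> 'x::real_normed_vector) \<Rightarrow> real \<Rightarrow> 'x" where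
  "RL_deriv t0 t1 \<alpha> f = (SOME g. is_continuous_RL_deriv t0 t1 \<alpha> f g)"

definition RL_space :: "real \<Rightarrow> real \<Rightarrow> real \<Rightarrow> (real \<Rightarrow> 'x::real_normed_vector) set" where
  "RL_space t0 t1 \<alpha> =
     (if \<alpha> = 0 then C_space t0 t1 0
      else {f \<in> C_space t0 t1 (nat \<lceil>\<alpha>\<rceil> - 1). \<exists>g. is_continuous_RL_deriv t0 t1 \<alpha> f g})"

definition RL_norm :: "real \<Rightarrow> real \<Rightarrow> real \<Rightarrow> (real \<Rightarrow> 'x::real_normed_vector) \<Rightarrow> real" where
  "RL_norm t0 t1 \<alpha> f =
     (if \<alpha> = 0 then C_norm t0 t1 0 f
      else C_norm t0 t1 (nat \<lceil>\<alpha>\<rceil> - 1) f + (SUP t\<in>{t0..t1}. norm (RL_deriv t0 t1 \<alpha> f t)))"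

end

(*
  The idea: on functions continuous on [t0,t1] the fractional integrals J^a form a semigroup,
  J^a J^b = J^(a+b). This is an explicit Beta integral on monomials, and monomials with vector
  coefficients are dense (Bernstein), so no Fubini theorem for singular kernels is needed.
  If beta is not a natural number, n = ceiling beta and c = n - beta, a continuous weak derivative g
  of order n of J^c f gives J^c f = J^n g + (a polynomial of degree < n) by du Bois-Reymond;
  cancelling J^c yields f = J^beta g + sum_(0<k<n) (t-t0)^(k-c) v_k, and f in C^(n-1) forces v_k = 0.
  Hence RL^beta = J^beta(C^0), while RL^n = C^n for natural n.
  The inclusions are then J^beta g = J^alpha (J^(beta-alpha) g) and J^beta(C^0) <= C^(n-1).
  They are strict because J^c x = J^d g with c < d and x constant forces x = J^(d-c) g, which
  vanishes at t0. For the last claim: constants are in C^n, but elements of J^alpha(C^0) vanish at t0.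
*)
theory Submission
  imports Defs
begin

text \<open>X may be non-separable. The Bochner integrals of the definitions are therefore converted
  once into Henstock-Kurzweil integrals, which ask for no measurability of vector-valued functions,
  and all later analysis is done with these. Density of polynomials is usable because J^a is bounded
  for the supremum norm, by (t1 - t0)^a / Gamma(a + 1). The same number with a = \<beta> - \<alpha>
  is the source of the continuity constant when neither order is natural. In recovering f from its
  weak derivative, the power (t - t0)^0 drops out because J^c f and J^n g vanish at t0. The powers
  (t - t0)^(k-c) with 0 < k < n are continuous, but no nontrivial combination of them is of class
  C^(n-1). For natural \<alpha> = m the space RL^m = C^m is larger than the range of J^m, and a
  separate witness of strictness is taken: J^\<gamma> x with \<gamma> strictly between m and
  min(\<beta>, m + 1), whose m-th derivative behaves like (t - t0)^(\<gamma> - m) at t0.\<close>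

section \<open>Bochner and Henstock--Kurzweil integrals\<close>

lemma norm_diff_triangle_three: "norm (p - x) \<le> norm (p - q) + norm (q - y) + norm (y - x)"
  for p q x y :: "'b::real_normed_vector"
  using norm_triangle_ineq[of "p - q" "q - x"] norm_triangle_ineq[of "q - y" "y - x"] by simp

text \<open>
  A bound by \<open>h\<close> with small integral controls Riemann sums, so Henstock--Kurzweil integrability
  of a vector-valued function can be read off from approximations without a separability assumption.
\<close>

lemma has_integral_approximation:
  fixes f :: "real \<Rightarrow> 'b::real_normed_vector"
  assumes h: "\<And>i. (h i has_integral I i) {a..b}"
    and s: "\<And>i. (s i has_integral y i) {a..b}"
    and le: "\<And>i t. t \<in> {a..b} \<Longrightarrow> norm (f t - s i t) \<le> h i t"
    and I: "I \<longlonglongrightarrow> 0" and y: "y \<longlonglongrightarrow> x"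
  shows "(f has_integral x) {a..b}"
  unfolding has_integral_real
proof (intro allI impI)
  fix e :: real assume "e > 0"
  \<comment> \<open>Error budget: the sums of \<open>f\<close> and \<open>s i\<close> differ by at
    most the Riemann sum of \<open>h i\<close>, which is below \<open>I i\<close> + e/4 and so below
    e/2; the sum of \<open>s i\<close> is within e/4 of \<open>y i\<close>, and \<open>y i\<close>
    within e/4 of \<open>x\<close>. One index i is fixed first, so both gauges may depend on
    it.\<close>
  then have e4: "e / 4 > 0" by simp
  have "eventually (\<lambda>i. dist (I i) 0 < e/4 \<and> dist (y i) x < e/4) sequentially"
    using tendstoD[OF I e4] tendstoD[OF y e4] by eventually_elim auto
  then obtain i where i: "\<bar>I i\<bar> < e/4" "norm (y i - x) < e/4"
    by (auto simp: eventually_sequentially dist_norm)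
  obtain g1 where g1: "gauge g1" "\<And>D. D tagged_division_of {a..b} \<Longrightarrow> g1 fine D \<Longrightarrow>
      norm ((\<Sum>(x,k)\<in>D. measure lborel k *\<^sub>R h i x) - I i) < e/4"
    using h[of i, unfolded has_integral_real, THEN spec, THEN mp, OF e4] by (elim exE conjE) simp
  obtain g2 where g2: "gauge g2" "\<And>D. D tagged_division_of {a..b} \<Longrightarrow> g2 fine D \<Longrightarrow>
      norm ((\<Sum>(x,k)\<in>D. measure lborel k *\<^sub>R s i x) - y i) < e/4"
    using s[of i, unfolded has_integral_real, THEN spec, THEN mp, OF e4] by (elim exE conjE) simp
  show "\<exists>\<gamma>. gauge \<gamma> \<and> (\<forall>D. D tagged_division_of {a..b} \<and> \<gamma> fine D \<longrightarrow>
      norm ((\<Sum>(x,k)\<in>D. measure lborel k *\<^sub>R f x) - x) < e)"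
  proof (intro exI[of _ "\<lambda>x. g1 x \<inter> g2 x"] conjI allI impI)
    show "gauge (\<lambda>x. g1 x \<inter> g2 x)"
      using g1(1) g2(1) by (rule gauge_Int)
    fix D assume D: "D tagged_division_of {a..b} \<and> (\<lambda>x. g1 x \<inter> g2 x) fine D"
    then have f1: "g1 fine D" and f2: "g2 fine D"
      by (auto simp: fine_Int)
    have tag: "t \<in> {a..b}" if "(t, k) \<in> D" for t k
      using D that by (meson tag_in_interval)
    have "norm ((\<Sum>(x,k)\<in>D. measure lborel k *\<^sub>R f x) - (\<Sum>(x,k)\<in>D. measure lborel k *\<^sub>R s i x))
        = norm (\<Sum>(x,k)\<in>D. measure lborel k *\<^sub>R (f x - s i x))"
      by (simp add: sum_subtractf[symmetric] scaleR_diff_right case_prod_unfold)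
    also have "\<dots> \<le> (\<Sum>(x,k)\<in>D. measure lborel k *\<^sub>R h i x)"
      by (rule sum_norm_le) (auto intro!: mult_left_mono le tag)
    also have "\<dots> < e/2"
      using g1(2)[OF conjunct1[OF D] f1] i(1) unfolding real_norm_def by linarith
    finally have 1: "norm ((\<Sum>(x,k)\<in>D. measure lborel k *\<^sub>R f x) - (\<Sum>(x,k)\<in>D. measure lborel k *\<^sub>R s i x)) < e/2" .
    have 2: "norm ((\<Sum>(x,k)\<in>D. measure lborel k *\<^sub>R s i x) - y i) < e/4"
      using g2(2)[OF conjunct1[OF D] f2] .
    have "norm ((\<Sum>(x,k)\<in>D. measure lborel k *\<^sub>R f x) - x) \<le>
        norm ((\<Sum>(x,k)\<in>D. measure lborel k *\<^sub>R f x) - (\<Sum>(x,k)\<in>D. measure lborel k *\<^sub>R s i x)) +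
        norm ((\<Sum>(x,k)\<in>D. measure lborel k *\<^sub>R s i x) - y i) + norm (y i - x)"
      by (rule norm_diff_triangle_three)
    then show "norm ((\<Sum>(x,k)\<in>D. measure lborel k *\<^sub>R f x) - x) < e"
      using 1 2 i(2) by linarith
  qed
qed

text \<open>A simple function is a finite sum of indicators of its level sets times vectors. Only
  the real indicators have to be integrated, and they are Lebesgue integrable because S has finite
  measure.\<close>

lemma simple_bochner_integral_has_integral:
  fixes s :: "real \<Rightarrow> 'b::real_normed_vector"
  assumes S: "S \<in> lmeasurable"
    and s: "Bochner_Integration.simple_bochner_integrable (lebesgue_on S) s"
  shows "(s has_integral Bochner_Integration.simple_bochner_integral (lebesgue_on S) s) S"
proof -
  have SL: "S \<in> sets lebesgue" using S by (rule fmeasurableD)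
  have sf: "simple_function (lebesgue_on S) s"
    using s by (auto elim: simple_bochner_integrable.cases)
  then have fin: "finite (s ` S)"
    by (auto dest: simple_functionD(1))
  have ind: "(indicat_real {x\<in>S. s x = y} has_integral measure (lebesgue_on S) {x\<in>S. s x = y}) S" for y
  proof -
    have m: "{x\<in>S. s x = y} \<in> sets (lebesgue_on S)"
      using simple_functionD(2)[OF sf, of "{y}"] by (simp add: vimage_def Int_def conj_commute)
    have eq: "{x\<in>S. s x = y} \<inter> S = {x\<in>S. s x = y}" by auto
    have "emeasure (lebesgue_on S) {x\<in>S. s x = y} \<le> emeasure (lebesgue_on S) (space (lebesgue_on S))"
      by (rule emeasure_space)
    also have "\<dots> < \<infinity>"
      using S SL fmeasurableD2[OF S] by (simp add: emeasure_restrict_space less_top[symmetric] del: emeasure_completion)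
    finally have "integrable (lebesgue_on S) (indicat_real {x\<in>S. s x = y})"
      using m eq by (simp add: integrable_indicator_iff)
    from has_integral_integral_lebesgue_on[OF this SL] show ?thesis
      using eq by simp
  qed
  have "((\<lambda>t. \<Sum>y\<in>s ` S. indicat_real {x\<in>S. s x = y} t *\<^sub>R y) has_integral
      (\<Sum>y\<in>s ` S. measure (lebesgue_on S) {x\<in>S. s x = y} *\<^sub>R y)) S"
    by (intro has_integral_sum fin has_integral_scaleR_left ind)
  moreover have "(\<Sum>y\<in>s ` S. indicat_real {x\<in>S. s x = y} t *\<^sub>R y) = s t" if "t \<in> S" for t
  proof -
    have "(\<Sum>y\<in>s ` S. indicat_real {x\<in>S. s x = y} t *\<^sub>R y) = (\<Sum>y\<in>{s t}. indicat_real {x\<in>S. s x = y} t *\<^sub>R y)"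
      using that by (intro sum.mono_neutral_right fin) (auto simp: indicator_def)
    then show ?thesis using that by simp
  qed
  ultimately show ?thesis
    unfolding Bochner_Integration.simple_bochner_integral_def
    by (auto intro: has_integral_eq[rotated])
qed

text \<open>In a non-separable space the difference of two measurable functions can fail to be
  measurable. Here one of them has finitely many values, so constants are treated first and the
  results are glued along the level sets.\<close>

lemma borel_measurable_norm_diff_simple:
  fixes f s :: "'a \<Rightarrow> 'b::real_normed_vector"
  assumes f: "f \<in> borel_measurable M" and s: "simple_function M s"
  shows "(\<lambda>y. norm (f y - s y)) \<in> borel_measurable M"
proof -
  have s': "s \<in> measurable M (count_space (s ` space M))"
    using measurable_simple_function[OF s] by (auto simp: measurable_def)
  have c: "(\<lambda>y. norm (f y - c)) \<in> borel_measurable M" for c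
  proof -
    have "(\<lambda>z. norm (z - c)) \<in> borel_measurable borel"
      by (intro borel_measurable_continuous_onI continuous_intros)
    from measurable_compose[OF f this] show ?thesis .
  qed
  show ?thesis
    using measurable_compose_countable'[where f="\<lambda>c y. norm (f y - c)", OF c s'
      countable_finite[OF simple_functionD(1)[OF s]]] .
qed

text \<open>The approximating simple functions feed \<open>has_integral_approximation\<close> after
  extension by 0 to {a..b}: the real bound is norm (f - s i), whose integral tends to 0 by the
  definition of the Bochner integral.\<close>

lemma has_Bochner_has_integral:
  fixes f :: "real \<Rightarrow> 'b::banach"
  assumes S: "S \<in> sets lebesgue" "S \<subseteq> {a..b}"
    and f: "has_Bochner (lebesgue_on S) f x"
  shows "(f has_integral x) S"
proof -
  let ?M = "lebesgue_on S"
  have Sm: "S \<in> lmeasurable"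
    using bounded_set_imp_lmeasurable[OF bounded_subset[OF bounded_closed_interval S(2)] S(1)] .
  from f obtain s where fm: "f \<in> borel_measurable ?M"
    and s: "\<And>i. Bochner_Integration.simple_bochner_integrable ?M (s i)"
    and lim: "(\<lambda>i. \<integral>\<^sup>+ y. ennreal (norm (f y - s i y)) \<partial>?M) \<longlonglongrightarrow> 0"
    and x: "(\<lambda>i. Bochner_Integration.simple_bochner_integral ?M (s i)) \<longlonglongrightarrow> x"
    unfolding has_Bochner_def by blast
  have meas: "(\<lambda>y. norm (f y - s i y)) \<in> borel_measurable ?M" for i
    using s[of i] by (intro borel_measurable_norm_diff_simple fm) (auto elim: simple_bochner_integrable.cases)
  \<comment> \<open>The first few distances in the approximating sequence may be infinite; shifting
    it by N makes every real bound integrable.\<close>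
  have "eventually (\<lambda>i. (\<integral>\<^sup>+ y. ennreal (norm (f y - s i y)) \<partial>?M) < 1) sequentially"
    using lim by (rule order_tendstoD) simp
  then obtain N where N: "\<And>i. i \<ge> N \<Longrightarrow> (\<integral>\<^sup>+ y. ennreal (norm (f y - s i y)) \<partial>?M) < 1"
    by (auto simp: eventually_sequentially)
  have int: "integrable ?M (\<lambda>y. norm (f y - s (i + N) y))" for i
    by (rule integrableI_bounded) (use N[of "i + N"] meas in \<open>auto simp: less_top intro: order.strict_trans\<close>)
  define I where "I i = integral\<^sup>L ?M (\<lambda>y. norm (f y - s (i + N) y))" for i
  have "(\<lambda>i. ennreal (I i)) \<longlonglongrightarrow> ennreal 0"
    using LIMSEQ_ignore_initial_segment[OF lim, of N] nn_integral_eq_integral[OF int]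
    by (simp add: I_def)
  then have I0: "I \<longlonglongrightarrow> 0"
    by (subst (asm) tendsto_ennreal_iff) (auto simp: I_def)
  have "((\<lambda>t. if t \<in> S then f t else 0) has_integral x) {a..b}"
  proof (rule has_integral_approximation)
    show "((\<lambda>t. if t \<in> S then norm (f t - s (i + N) t) else 0) has_integral I i) {a..b}" for i
      using has_integral_integral_lebesgue_on[OF int S(1), of i] S(2)
      by (simp add: I_def has_integral_restrict)
    show "((\<lambda>t. if t \<in> S then s (i + N) t else 0) has_integral
        Bochner_Integration.simple_bochner_integral ?M (s (i + N))) {a..b}" for i
      using simple_bochner_integral_has_integral[OF Sm s] S(2) by (simp add: has_integral_restrict)
    show "(\<lambda>i. Bochner_Integration.simple_bochner_integral ?M (s (i + N))) \<longlonglongrightarrow> x"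
      using LIMSEQ_ignore_initial_segment[OF x] .
  qed (use I0 in auto)
  then show ?thesis
    using S(2) by (simp add: has_integral_restrict)
qed

text \<open>The uniqueness that \<open>THE\<close> requires is inherited from the uniqueness of the
  Henstock-Kurzweil integral.\<close>

lemma Bochner_eq_integral:
  fixes f :: "real \<Rightarrow> 'b::banach"
  assumes S: "S \<in> sets lebesgue" "S \<subseteq> {a..b}"
    and f: "Bochner_integrable (lebesgue_on S) f"
  shows "f integrable_on S" "Bochner (lebesgue_on S) f = integral S f"
proof -
  obtain x where x: "has_Bochner (lebesgue_on S) f x"
    using f by (auto simp: Bochner_integrable_def)
  note hi = has_Bochner_has_integral[OF S]
  show "f integrable_on S" using hi[OF x] by blast
  have "(THE x. has_Bochner (lebesgue_on S) f x) = x"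
    using x has_integral_unique[OF hi hi] by (intro the_equality)
  then show "Bochner (lebesgue_on S) f = integral S f"
    using f hi[OF x] by (simp add: Bochner_def integral_unique)
qed

text \<open>Only real-valued functions need measurable approximation: K approximates the scalar k, F
  approximates the identity t, and composing the continuous f with F gives vector-valued simple
  functions. Since k is merely integrable, singular kernels are covered.\<close>

lemma Bochner_integrable_scaleR_continuous:
  fixes f h :: "real \<Rightarrow> 'b::banach" and k :: "real \<Rightarrow> real"
  assumes S: "S \<in> sets lebesgue" "S \<subseteq> {a..b}"
    and k: "integrable (lebesgue_on S) k" and f: "continuous_on {a..b} f"
    and h: "\<And>t. t \<in> S \<Longrightarrow> h t = k t *\<^sub>R f t"
  shows "Bochner_integrable (lebesgue_on S) h"
proof -
  let ?M = "lebesgue_on S"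
  let ?int = "Bochner_Integration.simple_bochner_integral ?M"
  have sp: "space ?M = S" by simp
  have km: "k \<in> borel_measurable ?M" using k by auto
  have idm: "(\<lambda>t::real. t) \<in> borel_measurable ?M"
    by (intro measurable_restrict_space1 measurable_completion) simp
  obtain K where K: "\<And>i. simple_function ?M (K i)" "\<And>t. t \<in> S \<Longrightarrow> (\<lambda>i. K i t) \<longlonglongrightarrow> k t"
      "\<And>i t. t \<in> S \<Longrightarrow> norm (K i t) \<le> 2 * norm (k t)"
    using borel_measurable_implies_sequence_metric[OF km, of 0] by (auto simp: dist_norm) metis
  obtain F where F: "\<And>i. simple_function ?M (F i)" "\<And>t. t \<in> S \<Longrightarrow> (\<lambda>i. F i t) \<longlonglongrightarrow> t"
    using borel_measurable_implies_sequence_metric[OF idm, of 0] by auto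
  \<comment> \<open>The simple approximations F of t may leave the interval; p clamps them back to
    where f is continuous and bounded.\<close>
  define p where "p t = max a (min b t)" for t :: real
  define s where "s i t = K i t *\<^sub>R f (p (F i t))" for i t
  have ss: "simple_function ?M (s i)" for i
    unfolding s_def by (rule simple_function_compose2[OF K(1) F(1)])
  have lim: "(\<lambda>i. s i t) \<longlonglongrightarrow> h t" if t: "t \<in> S" for t
  proof -
    have ab: "t \<in> {a..b}" "a \<le> b" using t S(2) by auto
    have "(\<lambda>i. p (F i t)) \<longlonglongrightarrow> p t"
      unfolding p_def by (intro tendsto_intros F(2) t)
    then have "(\<lambda>i. f (p (F i t))) \<longlonglongrightarrow> f t"
      by (intro continuous_on_tendsto_compose[OF f]) (use ab in \<open>auto simp: p_def\<close>)
    then show ?thesis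
      unfolding s_def h[OF t] by (intro tendsto_intros K(2) t)
  qed
  have "bounded (f ` {a..b})"
    by (intro compact_imp_bounded compact_continuous_image f compact_Icc)
  then obtain B where B0: "B > 0" and B: "\<And>t. t \<in> {a..b} \<Longrightarrow> norm (f t) \<le> B"
    unfolding bounded_pos by blast
  have hm: "h \<in> borel_measurable ?M"
    by (rule borel_measurable_LIMSEQ_metric[where f=s])
      (use lim borel_measurable_simple_function[OF ss] in auto)
  have sbd: "norm (s i t) \<le> 2 * B * norm (k t)" if "t \<in> S" for i t
  proof -
    have "p (F i t) \<in> {a..b}" using that S(2) by (auto simp: p_def)
    then have "norm (s i t) \<le> (2 * norm (k t)) * B"
      unfolding s_def norm_scaleR real_norm_def[symmetric] by (intro mult_mono K(3) B that) auto
    then show ?thesis by (simp add: mult_ac)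
  qed
  have kfin: "(\<integral>\<^sup>+ t. ennreal (c * norm (k t)) \<partial>?M) < \<infinity>" if "c \<ge> 0" for c
  proof -
    have "integrable ?M (\<lambda>t. c * norm (k t))" using k by auto
    from nn_integral_eq_integral[OF this] show ?thesis using that by simp
  qed
  have si: "Bochner_Integration.simple_bochner_integrable ?M (s i)" for i
  proof (rule simple_bochner_integrableI_bounded[OF ss])
    show "(\<integral>\<^sup>+ t. ennreal (norm (s i t)) \<partial>?M) < \<infinity>"
    proof -
      have "(\<integral>\<^sup>+ t. ennreal (norm (s i t)) \<partial>?M) \<le> (\<integral>\<^sup>+ t. ennreal (2 * B * norm (k t)) \<partial>?M)"
        by (intro nn_integral_mono ennreal_leI) (use sbd in auto)
      also have "\<dots> < \<infinity>" using B0 by (intro kfin) auto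
      finally show ?thesis .
    qed
  qed
  define E where "E i = (\<integral>\<^sup>+ t. ennreal (norm (h t - s i t)) \<partial>?M)" for i
  have E0: "E \<longlonglongrightarrow> 0"
  proof -
    have "(\<lambda>i. \<integral>\<^sup>+ t. ennreal (norm (h t - s i t)) \<partial>?M) \<longlonglongrightarrow> (\<integral>\<^sup>+ t. 0 \<partial>?M)"
    \<comment> \<open>Each \<open>s i\<close> is bounded by 2 * B * norm (k t), its limit h obeys
      the same bound, and the difference is bounded by the sum of the two.\<close>
    proof (rule nn_integral_dominated_convergence[where w="\<lambda>t. ennreal (4 * B * norm (k t))"])
      show "(\<lambda>t. ennreal (norm (h t - s i t))) \<in> borel_measurable ?M" for i
        by (rule measurable_compose[OF borel_measurable_norm_diff_simple[OF hm ss] measurable_ennreal])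
      show "(\<lambda>t. ennreal (4 * B * norm (k t))) \<in> borel_measurable ?M"
        using km by measurable
      show "AE t in ?M. ennreal (norm (h t - s i t)) \<le> ennreal (4 * B * norm (k t))" for i
      proof (rule AE_I2, rule ennreal_leI)
        fix t assume "t \<in> space ?M"
        then have t: "t \<in> S" by simp
        have "norm (h t) \<le> 2 * B * norm (k t)"
          by (rule Lim_norm_ubound[OF _ lim[OF t]]) (use sbd[OF t] in auto)
        then show "norm (h t - s i t) \<le> 4 * B * norm (k t)"
          using sbd[OF t, of i] norm_triangle_ineq4[of "h t" "s i t"] by linarith
      qed
      show "(\<integral>\<^sup>+ t. ennreal (4 * B * norm (k t)) \<partial>?M) < \<infinity>"
        using B0 by (intro kfin) auto
      show "AE t in ?M. (\<lambda>i. ennreal (norm (h t - s i t))) \<longlonglongrightarrow> 0"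
      proof (rule AE_I2)
        fix t assume "t \<in> space ?M"
        then have "(\<lambda>i. norm (h t - s i t)) \<longlonglongrightarrow> norm (h t - h t)"
          by (intro tendsto_intros lim) simp
        then show "(\<lambda>i. ennreal (norm (h t - s i t))) \<longlonglongrightarrow> 0"
          using tendsto_ennrealI by fastforce
      qed
    qed simp
    then show ?thesis by (simp add: E_def[abs_def])
  qed
  \<comment> \<open>The integrals of the \<open>s i\<close> form a Cauchy sequence, as their L^1
    distances are estimated through h; completeness then supplies the Bochner value.\<close>
  have diff: "ennreal (norm (?int (s i) - ?int (s j))) \<le> E i + E j" for i j
  proof -
    have "ennreal (norm (?int (s i) - ?int (s j))) = norm (?int (\<lambda>t. s i t - s j t))"
      using si by (subst simple_bochner_integral_diff) auto
    also have "\<dots> \<le> ?int (\<lambda>t. norm (s i t - s j t))"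
      using simple_bochner_integrable_compose2[of "(-)" ?M "s i" "s j"] si
      by (auto intro!: simple_bochner_integral_norm_bound)
    also have "\<dots> = (\<integral>\<^sup>+t. norm (s i t - s j t) \<partial>?M)"
      using simple_bochner_integrable_compose2[of "\<lambda>x y. norm (x - y)" ?M "s i" "s j"] si
      by (auto intro!: simple_bochner_integral_eq_nn_integral)
    also have "\<dots> \<le> (\<integral>\<^sup>+t. ennreal (norm (h t - s i t)) + ennreal (norm (h t - s j t)) \<partial>?M)"
    proof (rule nn_integral_mono)
      fix t
      show "ennreal (norm (s i t - s j t)) \<le> ennreal (norm (h t - s i t)) + ennreal (norm (h t - s j t))"
        using norm_triangle_ineq4[of "h t - s j t" "h t - s i t"]
        by (simp add: ennreal_plus[symmetric] add.commute del: ennreal_plus)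
    qed
    also have "\<dots> = E i + E j"
      unfolding E_def
      by (intro nn_integral_add measurable_compose[OF borel_measurable_norm_diff_simple[OF hm ss] measurable_ennreal])
    finally show ?thesis .
  qed
  have "Cauchy (\<lambda>i. ?int (s i))"
  proof (rule metric_CauchyI)
    fix e :: real assume e: "e > 0"
    have "eventually (\<lambda>i. E i < ennreal (e/2)) sequentially"
      using E0 e by (intro order_tendstoD) auto
    then obtain N where N: "\<And>i. i \<ge> N \<Longrightarrow> E i < ennreal (e/2)"
      by (auto simp: eventually_sequentially)
    show "\<exists>N. \<forall>m\<ge>N. \<forall>n\<ge>N. dist (?int (s m)) (?int (s n)) < e"
    proof (intro exI allI impI)
      fix m n assume "N \<le> m" "N \<le> n"
      then have "E m + E n < ennreal (e/2) + ennreal (e/2)"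
        by (intro add_strict_mono N)
      also have "\<dots> = ennreal e"
        using e by (subst ennreal_plus[symmetric]) auto
      finally have "ennreal (norm (?int (s m) - ?int (s n))) < ennreal e"
        by (rule le_less_trans[OF diff])
      then show "dist (?int (s m)) (?int (s n)) < e"
        unfolding dist_norm by (rule ennreal_less_iff[OF norm_ge_zero, THEN iffD1])
    qed
  qed
  then obtain x where "(\<lambda>i. ?int (s i)) \<longlonglongrightarrow> x"
    using Cauchy_convergent convergent_def by blast
  then have "has_Bochner ?M h x"
    unfolding has_Bochner_def using hm si E0 unfolding E_def by blast
  then show ?thesis by (auto simp: Bochner_integrable_def)
qed

section \<open>Fractional integrals of continuous functions\<close>

lemma sum_Bernstein_variance:
  assumes "n > 0"
  shows "(\<Sum>k\<le>n. (x - real k / real n)\<^sup>2 * Bernstein n k x) = x * (1 - x) / real n"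
proof -
  have "(\<Sum>k\<le>n. (real n)\<^sup>2 * ((x - real k / real n)\<^sup>2 * Bernstein n k x)) =
      (\<Sum>k\<le>n. real k * (real k - 1) * Bernstein n k x + (1 - 2 * real n * x) * (real k * Bernstein n k x)
        + (real n * x)\<^sup>2 * Bernstein n k x)"
    using assms by (intro sum.cong refl) (simp add: field_simps power2_eq_square)
  also have "\<dots> = real n * (real n - 1) * x\<^sup>2 + (1 - 2 * real n * x) * (real n * x) + (real n * x)\<^sup>2"
    by (simp add: sum.distrib sum_distrib_left[symmetric])
  also have "\<dots> = real n * (x * (1 - x))"
    by (simp add: algebra_simps power2_eq_square)
  finally have "(real n)\<^sup>2 * (\<Sum>k\<le>n. (x - real k / real n)\<^sup>2 * Bernstein n k x) = real n * (x * (1 - x))"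
    by (simp add: sum_distrib_left)
  then have "real n * (\<Sum>k\<le>n. (x - real k / real n)\<^sup>2 * Bernstein n k x) = x * (1 - x)"
    using assms unfolding power2_eq_square mult.assoc mult_cancel_left by simp
  then show ?thesis using assms by (simp add: eq_divide_eq mult.commute)
qed

text \<open>Chebyshev's argument: the Bernstein weights are nonnegative with sum 1, and the variance
  x(1 - x)/n controls the nodes far from x. Only norms of f enter the estimate, so vector values
  cause no difficulty.\<close>

lemma Bernstein_Weierstrass_vector:
  fixes f :: "real \<Rightarrow> 'b::real_normed_vector"
  assumes f: "continuous_on {0..1} f" and e: "e > 0"
  shows "\<exists>n. \<forall>x\<in>{0..1}. norm (f x - (\<Sum>k\<le>n. Bernstein n k x *\<^sub>R f (real k / real n))) < e"
proof -
  have "bounded (f ` {0..1})"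
    by (intro compact_imp_bounded compact_continuous_image f compact_Icc)
  then obtain M where M: "\<And>x. x \<in> {0..1} \<Longrightarrow> norm (f x) \<le> M"
    unfolding bounded_iff by blast
  have M0: "M \<ge> 0" using M[of 0] norm_ge_zero[of "f 0"] by (simp del: norm_ge_zero)
  obtain d where d: "d > 0" "\<And>x y. x \<in> {0..1} \<Longrightarrow> y \<in> {0..1} \<Longrightarrow> dist y x < d \<Longrightarrow> dist (f y) (f x) < e/2"
    using compact_uniformly_continuous[OF f compact_Icc] e
    unfolding uniformly_continuous_on_def by (metis half_gt_zero)
  \<comment> \<open>Chosen so that K * d^2 = 2 * M: for points at distance at least d the trivial
    bound 2 * M is then dominated by the quadratic term.\<close>
  define K where "K = 2 * M / d\<^sup>2"
  have K0: "K \<ge> 0" using M0 by (simp add: K_def)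
  have est: "norm (f x - f y) \<le> e/2 + K * (x - y)\<^sup>2" if "x \<in> {0..1}" "y \<in> {0..1}" for x y
  proof (cases "dist x y < d")
    case True
    have "K * (x - y)\<^sup>2 \<ge> 0" using K0 by simp
    then show ?thesis using d(2)[OF that(2,1) True] by (simp add: dist_norm)
  next
    case False
    then have "d\<^sup>2 \<le> (x - y)\<^sup>2"
      using d(1) by (metis abs_le_square_iff abs_of_pos dist_real_def not_le)
    then have "2 * M \<le> K * (x - y)\<^sup>2"
      using M0 d(1) by (simp add: K_def field_simps mult_left_mono)
    then show ?thesis
      using norm_triangle_ineq4[of "f x" "f y"] M[OF that(1)] M[OF that(2)] e by linarith
  qed
  \<comment> \<open>As x(1 - x) is at most 1, this n makes the averaged quadratic term smaller than
    e/2.\<close>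
  obtain n :: nat where n: "real n > 2 * K / e" using reals_Archimedean2 by blast
  then have n0: "n > 0" using K0 e by (cases n) (auto simp: field_simps)
  show ?thesis
  proof (intro exI ballI)
    fix x :: real assume x: "x \<in> {0..1}"
    have "f x - (\<Sum>k\<le>n. Bernstein n k x *\<^sub>R f (real k / real n)) =
        (\<Sum>k\<le>n. Bernstein n k x *\<^sub>R (f x - f (real k / real n)))"
      by (simp add: scaleR_diff_right sum_subtractf scaleR_sum_left[symmetric])
    then have "norm (f x - (\<Sum>k\<le>n. Bernstein n k x *\<^sub>R f (real k / real n)))
        = norm (\<Sum>k\<le>n. Bernstein n k x *\<^sub>R (f x - f (real k / real n)))" by simp
    also have "\<dots> \<le> (\<Sum>k\<le>n. Bernstein n k x * (e/2 + K * (x - real k / real n)\<^sup>2))"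
    proof (rule sum_norm_le)
      fix k assume "k \<in> {..n}"
      then have "real k / real n \<in> {0..1}" using n0 by (auto simp: field_simps)
      then show "norm (Bernstein n k x *\<^sub>R (f x - f (real k / real n)))
          \<le> Bernstein n k x * (e/2 + K * (x - real k / real n)\<^sup>2)"
        using x Bernstein_nonneg[of x n k] by (auto intro!: mult_left_mono est)
    qed
    also have "\<dots> = (\<Sum>k\<le>n. e/2 * Bernstein n k x + K * ((x - real k / real n)\<^sup>2 * Bernstein n k x))"
      by (simp add: algebra_simps)
    also have "\<dots> = e/2 + K * (x * (1 - x) / real n)"
      by (simp only: sum.distrib sum_distrib_left[symmetric] sum_Bernstein_variance[OF n0] sum_Bernstein mult_1_right)
    also have "\<dots> < e"
    proof -
      have "x * (1 - x) \<le> 1 * 1" using x by (intro mult_mono) auto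
      then have "K * (x * (1 - x) / real n) \<le> K * (1 / real n)"
        using K0 n0 by (intro mult_left_mono divide_right_mono) auto
      also have "\<dots> < e/2" using n n0 e by (simp add: field_simps)
      finally show ?thesis by linarith
    qed
    finally show "norm (f x - (\<Sum>k\<le>n. Bernstein n k x *\<^sub>R f (real k / real n))) < e" .
  qed
qed

text \<open>Induction principle for properties of continuous functions that are stable under sums
  and uniform limits. The powers are centred at the left end point because fractional integrals of
  (t - a)^k are explicit.\<close>

lemma continuous_on_monomial_induct:
  fixes f :: "real \<Rightarrow> 'b::real_normed_vector"
  assumes ab: "a < b" and f: "continuous_on {a..b} f"
    and monomial: "\<And>k v. Q (\<lambda>t. (t - a) ^ k *\<^sub>R v)"
    and add: "\<And>g h. continuous_on {a..b} g \<Longrightarrow> continuous_on {a..b} h \<Longrightarrow> Q g \<Longrightarrow> Q h \<Longrightarrow> Q (\<lambda>t. g t + h t)"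
    and lim: "\<And>g. continuous_on {a..b} g \<Longrightarrow>
      (\<And>e. e > 0 \<Longrightarrow> \<exists>h. continuous_on {a..b} h \<and> Q h \<and> (\<forall>t\<in>{a..b}. norm (g t - h t) \<le> e)) \<Longrightarrow> Q g"
  shows "Q f"
proof (rule lim[OF f])
  fix e :: real assume "e > 0"
  define F where "F x = f (a + (b - a) * x)" for x
  have "continuous_on {0..1} F"
    unfolding F_def
  proof (rule continuous_on_compose2[OF f])
    show "(\<lambda>x. a + (b - a) * x) ` {0..1} \<subseteq> {a..b}"
    proof (rule image_subsetI)
      fix x :: real assume x: "x \<in> {0..1}"
      then have "a + (b - a) * x \<le> a + (b - a) * 1"
        using ab by (intro add_left_mono mult_left_mono) auto
      moreover have "0 \<le> (b - a) * x" using x ab by simp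
      ultimately show "a + (b - a) * x \<in> {a..b}" by simp
    qed
  qed (intro continuous_intros)
  from Bernstein_Weierstrass_vector[OF this \<open>e > 0\<close>] obtain n where
    n: "\<And>x. x \<in> {0..1} \<Longrightarrow> norm (F x - (\<Sum>k\<le>n. Bernstein n k x *\<^sub>R F (real k / real n))) < e" by blast
  \<comment> \<open>\<open>q k\<close> is the k-th Bernstein polynomial of (t - a)/(b - a), written
    as a \<open>poly\<close> in t - a. Its coefficients exhibit the approximation as a sum of vector
    monomials.\<close>
  define q where "q k = smult (real (n choose k)) ([:0, 1 / (b - a):] ^ k * [:1, - 1 / (b - a):] ^ (n - k))" for k
  define h where "h t = (\<Sum>k\<le>n. \<Sum>i\<le>degree (q k). (t - a) ^ i *\<^sub>R (coeff (q k) i *\<^sub>R F (real k / real n)))" for t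
  have q: "poly (q k) (t - a) = Bernstein n k ((t - a) / (b - a))" for k t
    by (simp add: q_def Bernstein_def algebra_simps)
  have h: "h t = (\<Sum>k\<le>n. Bernstein n k ((t - a) / (b - a)) *\<^sub>R F (real k / real n))" for t
    unfolding h_def q[symmetric] poly_altdef by (simp add: scaleR_sum_left mult.commute)
  have Qsum: "Q (\<lambda>t. \<Sum>i\<in>I. g i t) \<and> continuous_on {a..b} (\<lambda>t. \<Sum>i\<in>I. g i t)"
    if "finite I" "\<And>i. i \<in> I \<Longrightarrow> Q (g i) \<and> continuous_on {a..b} (g i)" for I :: "nat set" and g
    using that
  proof (induction I rule: finite_induct)
    case empty
    then show ?case using monomial[of 0 0] by simp
  next
    case (insert i I)
    then show ?case using add[of "g i" "\<lambda>t. \<Sum>i\<in>I. g i t"] by (auto intro!: continuous_intros)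
  qed
  have "Q h \<and> continuous_on {a..b} h"
    unfolding h_def by (intro Qsum conjI monomial continuous_intros finite_atMost)
  moreover have "norm (f t - h t) \<le> e" if "t \<in> {a..b}" for t
  proof -
    have "(t - a) / (b - a) \<in> {0..1}" using that ab by (auto simp: field_simps)
    moreover have "F ((t - a) / (b - a)) = f t" using ab by (simp add: F_def)
    ultimately show ?thesis unfolding h using n[of "(t - a) / (b - a)"] by simp
  qed
  ultimately show "\<exists>h. continuous_on {a..b} h \<and> Q h \<and> (\<forall>t\<in>{a..b}. norm (f t - h t) \<le> e)"
    by blast
qed

section \<open>Fractional integrals: Beta integrals, linearity and bounds\<close>

definition frac_integral :: "real \<Rightarrow> real \<Rightarrow> (real \<Rightarrow> 'x::banach) \<Rightarrow> real \<Rightarrow> 'x" where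
  "frac_integral a \<alpha> f t = (if \<alpha> = 0 then f t
     else (1 / Gamma \<alpha>) *\<^sub>R integral {a..t} (\<lambda>s. (t - s) powr (\<alpha> - 1) *\<^sub>R f s))"

lemma frac_integral_0 [simp]: "frac_integral a 0 f = f"
  by (simp add: frac_integral_def fun_eq_iff)

text \<open>Euler's Beta integral on [0,1] under the substitution x = (s - a)/(t - a). The factor (t
  - a)^(\<alpha> + r - 1) restores the two powers, and the Jacobian contributes one more t -
  a.\<close>

lemma has_integral_Beta_interval:
  fixes \<alpha> r :: real
  assumes "a < t" "\<alpha> > 0" "r > -1"
  shows "((\<lambda>s. (t - s) powr (\<alpha> - 1) * (s - a) powr r) has_integral
      Beta \<alpha> (r + 1) * (t - a) powr (\<alpha> + r)) {a..t}"
proof -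
  define m where "m = 1 / (t - a)"
  have m: "m > 0" using assms by (simp add: m_def)
  have "((\<lambda>x. x powr r * (1 - x) powr (\<alpha> - 1)) has_integral Beta (r + 1) \<alpha>) (cbox 0 1)"
    using has_integral_Beta_real[of "r + 1" \<alpha>] assms by simp
  note affine = has_integral_affinity'[OF this m, of "- a * m"]
  have "cbox ((0 - - a * m) /\<^sub>R m) ((1 - - a * m) /\<^sub>R m) = {a..t}"
    using m assms by (simp add: m_def field_simps)
  moreover have "Beta (r + 1) \<alpha> /\<^sub>R m ^ DIM(real) = Beta (r + 1) \<alpha> * (t - a)"
    using assms by (simp add: m_def field_simps)
  ultimately have "((\<lambda>s. (m *\<^sub>R s + - a * m) powr r * (1 - (m *\<^sub>R s + - a * m)) powr (\<alpha> - 1)) has_integral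
      Beta (r + 1) \<alpha> * (t - a)) {a..t}"
    using affine by (simp only:)
  then have "((\<lambda>s. (t - a) powr (\<alpha> + r - 1) * ((m *\<^sub>R s + - a * m) powr r * (1 - (m *\<^sub>R s + - a * m)) powr (\<alpha> - 1)))
      has_integral (t - a) powr (\<alpha> + r - 1) * (Beta (r + 1) \<alpha> * (t - a))) {a..t}"
    by (rule has_integral_mult_right)
  moreover have "(t - a) powr (\<alpha> + r - 1) * ((m *\<^sub>R s + - a * m) powr r * (1 - (m *\<^sub>R s + - a * m)) powr (\<alpha> - 1)) =
      (t - s) powr (\<alpha> - 1) * (s - a) powr r" if "s \<in> {a..t}" for s
  proof -
    have eq1: "m *\<^sub>R s + - a * m = (s - a) / (t - a)"
      by (simp add: m_def diff_divide_distrib)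
    have eq: "m *\<^sub>R s + - a * m = (s - a) / (t - a)" "1 - (m *\<^sub>R s + - a * m) = (t - s) / (t - a)"
      unfolding eq1 using assms by (auto simp: field_simps)
    have "(t - a) powr (\<alpha> + r - 1) = (t - a) powr r * (t - a) powr (\<alpha> - 1)"
      by (simp add: powr_add[symmetric] algebra_simps)
    then show ?thesis
      unfolding eq(2) unfolding eq1 using that assms by (simp add: powr_divide)
  qed
  moreover have "(t - a) powr (\<alpha> + r - 1) * (Beta (r + 1) \<alpha> * (t - a)) = Beta \<alpha> (r + 1) * (t - a) powr (\<alpha> + r)"
    using assms by (simp add: powr_diff Beta_commute)
  ultimately show ?thesis
    by (metis (no_types, lifting) has_integral_eq)
qed

lemma integrable_powr_kernel:
  fixes \<alpha> :: real
  assumes "\<alpha> > 0"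
  shows "integrable (lebesgue_on {a..t}) (\<lambda>s. (t - s) powr (\<alpha> - 1))"
proof -
  have "(\<lambda>s. (t - s) powr (\<alpha> - 1)) integrable_on {a..t}"
  proof (cases "a < t")
    case True
    \<comment> \<open>The Beta integral with r = 0. The point a is exempted because
      \<open>0 powr 0\<close> is 0, so that (s - a) powr 0 fails to be 1 there.\<close>
    have "((\<lambda>s. (t - s) powr (\<alpha> - 1)) has_integral Beta \<alpha> (0 + 1) * (t - a) powr (\<alpha> + 0)) {a..t}"
      by (rule has_integral_spike_finite[OF _ _ has_integral_Beta_interval, of "{a}"])
        (use True assms in auto)
    then show ?thesis by blast
  next
    case False
    then consider "{a..t} = {}" | "t = a" by fastforce
    then show ?thesis
      by cases (use integrable_on_refl[of _ a] in \<open>auto simp del: atLeastatMost_empty_iff2\<close>)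
  qed
  then have "(\<lambda>s. (t - s) powr (\<alpha> - 1)) absolutely_integrable_on {a..t}"
    by (rule nonnegative_absolutely_integrable_1) simp
  then show ?thesis by (rule absolutely_integrable_imp_integrable) simp
qed

lemma frac_integral_integrable:
  fixes f :: "real \<Rightarrow> 'x::banach"
  assumes "continuous_on {a..b} f" "t \<le> b" "\<alpha> > 0"
  shows "(\<lambda>s. (t - s) powr (\<alpha> - 1) *\<^sub>R f s) integrable_on {a..t}"
    and "Bochner (lebesgue_on {a..t}) (\<lambda>s. (t - s) powr (\<alpha> - 1) *\<^sub>R f s) =
      integral {a..t} (\<lambda>s. (t - s) powr (\<alpha> - 1) *\<^sub>R f s)"
proof -
  have "Bochner_integrable (lebesgue_on {a..t}) (\<lambda>s. (t - s) powr (\<alpha> - 1) *\<^sub>R f s)"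
    using assms integrable_powr_kernel[of \<alpha> a t]
    by (intro Bochner_integrable_scaleR_continuous[where a=a and b=b]) auto
  from Bochner_eq_integral[OF _ order_refl this] show
    "(\<lambda>s. (t - s) powr (\<alpha> - 1) *\<^sub>R f s) integrable_on {a..t}"
    "Bochner (lebesgue_on {a..t}) (\<lambda>s. (t - s) powr (\<alpha> - 1) *\<^sub>R f s) =
      integral {a..t} (\<lambda>s. (t - s) powr (\<alpha> - 1) *\<^sub>R f s)" by auto
qed

text \<open>The passage from the Bochner integral of the definitions to the Henstock-Kurzweil
  integral in which the calculus below is carried out.\<close>

lemma RL_integral_eq_frac_integral:
  fixes f :: "real \<Rightarrow> 'x::banach"
  assumes "continuous_on {a..b} f" "t \<le> b" "\<alpha> \<ge> 0"
  shows "RL_integral a \<alpha> f t = frac_integral a \<alpha> f t"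
  using assms by (simp add: RL_integral_def frac_integral_def frac_integral_integrable(2))

lemma frac_integral_cong:
  assumes "\<And>s. s \<in> {a..t} \<Longrightarrow> f s = g s" "a \<le> t"
  shows "frac_integral a \<alpha> f t = frac_integral a \<alpha> g t"
proof -
  have "integral {a..t} (\<lambda>s. (t - s) powr (\<alpha> - 1) *\<^sub>R f s) =
      integral {a..t} (\<lambda>s. (t - s) powr (\<alpha> - 1) *\<^sub>R g s)"
    by (intro integral_cong) (simp add: assms)
  then show ?thesis using assms by (simp add: frac_integral_def)
qed

lemma frac_integral_add:
  fixes f g :: "real \<Rightarrow> 'x::banach"
  assumes "continuous_on {a..b} f" "continuous_on {a..b} g" "t \<le> b" "\<alpha> \<ge> 0"
  shows "frac_integral a \<alpha> (\<lambda>s. f s + g s) t = frac_integral a \<alpha> f t + frac_integral a \<alpha> g t"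
proof (cases "\<alpha> = 0")
  case False
  then have \<alpha>: "\<alpha> > 0" using assms by simp
  show ?thesis
    unfolding frac_integral_def scaleR_add_right if_not_P[OF False]
    by (subst Henstock_Kurzweil_Integration.integral_add)
      (simp_all add: frac_integral_integrable(1)[OF _ assms(3) \<alpha>] assms(1,2) scaleR_add_right)
qed (simp add: frac_integral_def)

lemma frac_integral_diff:
  fixes f g :: "real \<Rightarrow> 'x::banach"
  assumes "continuous_on {a..b} f" "continuous_on {a..b} g" "t \<le> b" "\<alpha> \<ge> 0"
  shows "frac_integral a \<alpha> (\<lambda>s. f s - g s) t = frac_integral a \<alpha> f t - frac_integral a \<alpha> g t"
proof (cases "\<alpha> = 0")
  case False
  then have \<alpha>: "\<alpha> > 0" using assms by simp
  show ?thesis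
    unfolding frac_integral_def scaleR_diff_right if_not_P[OF False]
    by (subst Henstock_Kurzweil_Integration.integral_diff)
      (simp_all add: frac_integral_integrable(1)[OF _ assms(3) \<alpha>] assms(1,2) scaleR_diff_right)
qed (simp add: frac_integral_def)

lemma frac_integral_scaleR:
  "frac_integral a \<alpha> (\<lambda>s. c *\<^sub>R f s) t = c *\<^sub>R frac_integral a \<alpha> f t"
proof (cases "\<alpha> = 0")
  case False
  then show ?thesis
    unfolding frac_integral_def if_not_P[OF False]
    by (simp only: scaleR_left_commute[of _ c] Henstock_Kurzweil_Integration.integral_cmul)
qed (simp add: frac_integral_def)

lemma frac_integral_zero [simp]: "frac_integral a \<alpha> (\<lambda>s. 0) t = 0"
  by (simp add: frac_integral_def)

lemma frac_integral_left: "\<alpha> > 0 \<Longrightarrow> frac_integral a \<alpha> f a = 0"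
  by (simp add: frac_integral_def)

lemma frac_integral_sum:
  fixes f :: "'i \<Rightarrow> real \<Rightarrow> 'x::banach"
  assumes "finite I" "\<And>i. i \<in> I \<Longrightarrow> continuous_on {a..b} (f i)" "t \<le> b" "\<alpha> \<ge> 0"
  shows "frac_integral a \<alpha> (\<lambda>s. \<Sum>i\<in>I. f i s) t = (\<Sum>i\<in>I. frac_integral a \<alpha> (f i) t)"
  using assms
proof (induction I rule: finite_induct)
  case (insert i I)
  then show ?case
    by (simp add: frac_integral_add[where b=b] continuous_on_sum)
qed simp

text \<open>The coefficient is Beta(\<alpha>, r + 1) / Gamma(\<alpha>). At t = a both sides are 0,
  because \<open>0 powr\<close> of any exponent is 0.\<close>

lemma frac_integral_powr:
  fixes v :: "'x::banach"
  assumes "\<alpha> > 0" "r > -1" "a \<le> t"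
  shows "frac_integral a \<alpha> (\<lambda>s. (s - a) powr r *\<^sub>R v) t =
    (Gamma (r + 1) / Gamma (\<alpha> + r + 1) * (t - a) powr (\<alpha> + r)) *\<^sub>R v"
proof (cases "a = t")
  case False
  with assms have "((\<lambda>s. ((t - s) powr (\<alpha> - 1) * (s - a) powr r) *\<^sub>R v) has_integral
      (Beta \<alpha> (r + 1) * (t - a) powr (\<alpha> + r)) *\<^sub>R v) {a..t}"
    by (intro has_integral_scaleR_left has_integral_Beta_interval) auto
  moreover have "Gamma \<alpha> \<noteq> 0" using Gamma_real_pos[OF assms(1)] by simp
  ultimately show ?thesis
    using assms by (simp add: frac_integral_def integral_unique Beta_def add.assoc)
qed (use assms in \<open>auto simp: frac_integral_left\<close>)

lemma frac_integral_power:
  fixes v :: "'x::banach"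
  assumes "\<alpha> > 0" "a \<le> t"
  shows "frac_integral a \<alpha> (\<lambda>s. (s - a) ^ k *\<^sub>R v) t =
    (fact k / Gamma (\<alpha> + real k + 1) * (t - a) powr (\<alpha> + real k)) *\<^sub>R v"
proof -
  \<comment> \<open>The two integrands differ only at s = a, and only for k = 0, where
    \<open>0 ^ 0\<close> is 1 but \<open>0 powr 0\<close> is 0.\<close>
  have "integral {a..t} (\<lambda>s. (t - s) powr (\<alpha> - 1) *\<^sub>R (s - a) ^ k *\<^sub>R v) =
      integral {a..t} (\<lambda>s. (t - s) powr (\<alpha> - 1) *\<^sub>R (s - a) powr real k *\<^sub>R v)"
    by (rule integral_spike[of "{a}"]) (auto simp: powr_realpow)
  then have "frac_integral a \<alpha> (\<lambda>s. (s - a) ^ k *\<^sub>R v) t = frac_integral a \<alpha> (\<lambda>s. (s - a) powr real k *\<^sub>R v) t"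
    using assms by (simp add: frac_integral_def del: scaleR_scaleR)
  then show ?thesis
    using assms by (simp add: frac_integral_powr Gamma_fact[symmetric] add.commute)
qed

lemma frac_integral_const:
  fixes v :: "'x::banach"
  assumes "\<alpha> > 0" "a \<le> t"
  shows "frac_integral a \<alpha> (\<lambda>s. v) t = ((t - a) powr \<alpha> / Gamma (\<alpha> + 1)) *\<^sub>R v"
  using frac_integral_power[OF assms, of 0 v] by simp

text \<open>The kernel is nonnegative, so J^\<alpha> f is dominated by J^\<alpha> of the constant B,
  which is known explicitly.\<close>

lemma norm_frac_integral_le:
  fixes f :: "real \<Rightarrow> 'x::banach"
  assumes f: "continuous_on {a..b} f" and B: "\<And>s. s \<in> {a..b} \<Longrightarrow> norm (f s) \<le> B"
    and t: "t \<in> {a..b}" and \<alpha>: "\<alpha> > 0"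
  shows "norm (frac_integral a \<alpha> f t) \<le> B * ((t - a) powr \<alpha> / Gamma (\<alpha> + 1))"
proof -
  have G: "Gamma \<alpha> > 0" using \<alpha> by (rule Gamma_real_pos)
  have "norm (integral {a..t} (\<lambda>s. (t - s) powr (\<alpha> - 1) *\<^sub>R f s)) \<le>
      integral {a..t} (\<lambda>s. (t - s) powr (\<alpha> - 1) *\<^sub>R B)"
    using t \<alpha> by (intro integral_norm_bound_integral frac_integral_integrable(1)[where b=b] f)
      (auto intro!: mult_left_mono B)
  then have "norm (frac_integral a \<alpha> f t) \<le> frac_integral a \<alpha> (\<lambda>s. B) t"
    using G \<alpha> by (simp add: frac_integral_def divide_right_mono)
  then show ?thesis
    using t \<alpha> by (simp add: frac_integral_const mult.commute)
qed


lemma norm_frac_integral_le':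
  fixes f :: "real \<Rightarrow> 'x::banach"
  assumes f: "continuous_on {a..b} f" and B: "\<And>s. s \<in> {a..b} \<Longrightarrow> norm (f s) \<le> B"
    and t: "t \<in> {a..b}" and \<alpha>: "\<alpha> > 0"
  shows "norm (frac_integral a \<alpha> f t) \<le> B * ((b - a) powr \<alpha> / Gamma (\<alpha> + 1))"
proof -
  have "B \<ge> 0" using B[OF t] norm_ge_zero order_trans by blast
  moreover have "Gamma (\<alpha> + 1) > 0" using \<alpha> by simp
  ultimately have "B * ((t - a) powr \<alpha> / Gamma (\<alpha> + 1)) \<le> B * ((b - a) powr \<alpha> / Gamma (\<alpha> + 1))"
    using t \<alpha> by (intro mult_left_mono divide_right_mono powr_mono2) auto
  then show ?thesis using norm_frac_integral_le[OF assms] by (rule order_trans[rotated])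
qed

section \<open>Continuity and semigroup law of fractional integrals\<close>

lemma continuous_on_powr_diff:
  fixes r :: real
  assumes "r > 0"
  shows "continuous_on {a..b} (\<lambda>t. (t - a) powr r)"
  using assms by (intro continuous_on_powr' continuous_intros) auto

text \<open>On monomials the fractional integral is an explicit continuous power. The supremum bound
  makes J^\<alpha> preserve uniform limits, so the singular kernel never has to be estimated at two
  different values of t.\<close>

lemma continuous_on_frac_integral:
  fixes f :: "real \<Rightarrow> 'x::banach"
  assumes ab: "a < b" and f: "continuous_on {a..b} f" and \<alpha>: "\<alpha> \<ge> 0"
  shows "continuous_on {a..b} (frac_integral a \<alpha> f)"
proof (cases "\<alpha> = 0")
  case True
  then show ?thesis using f by (simp add: frac_integral_def[abs_def])
next
  case False
  then have \<alpha>: "\<alpha> > 0" using \<alpha> by simp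
  define C where "C = (b - a) powr \<alpha> / Gamma (\<alpha> + 1)"
  have C: "C \<ge> 0" using \<alpha> Gamma_real_pos[of "\<alpha> + 1"] by (simp add: C_def)
  show ?thesis
  proof (rule continuous_on_monomial_induct[OF ab f])
    fix k and v :: 'x
    have "continuous_on {a..b} (\<lambda>t. (fact k / Gamma (\<alpha> + real k + 1) * (t - a) powr (\<alpha> + real k)) *\<^sub>R v)"
      using \<alpha> by (intro continuous_intros continuous_on_powr_diff) auto
    then show "continuous_on {a..b} (frac_integral a \<alpha> (\<lambda>t. (t - a) ^ k *\<^sub>R v))"
      by (rule continuous_on_eq) (simp add: frac_integral_power \<alpha>)
  next
    fix g h :: "real \<Rightarrow> 'x"
    assume *: "continuous_on {a..b} g" "continuous_on {a..b} h"
      "continuous_on {a..b} (frac_integral a \<alpha> g)" "continuous_on {a..b} (frac_integral a \<alpha> h)"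
    have "continuous_on {a..b} (\<lambda>t. frac_integral a \<alpha> g t + frac_integral a \<alpha> h t)"
      by (intro continuous_intros *)
    then show "continuous_on {a..b} (frac_integral a \<alpha> (\<lambda>t. g t + h t))"
      by (rule continuous_on_eq) (use * \<alpha> frac_integral_add[of a b g h _ \<alpha>] in auto)
  next
    fix g :: "real \<Rightarrow> 'x"
    assume g: "continuous_on {a..b} g"
      and "\<And>e. e > 0 \<Longrightarrow> \<exists>h. continuous_on {a..b} h \<and> continuous_on {a..b} (frac_integral a \<alpha> h) \<and>
        (\<forall>t\<in>{a..b}. norm (g t - h t) \<le> e)"
    then have "\<forall>n. \<exists>h. continuous_on {a..b} h \<and> continuous_on {a..b} (frac_integral a \<alpha> h) \<and>
        (\<forall>t\<in>{a..b}. norm (g t - h t) \<le> 1 / real (Suc n))" by simp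
    then obtain h where h: "\<And>n. continuous_on {a..b} (h n)" "\<And>n. continuous_on {a..b} (frac_integral a \<alpha> (h n))"
      "\<And>n t. t \<in> {a..b} \<Longrightarrow> norm (g t - h n t) \<le> 1 / real (Suc n)" by metis
    have le: "dist (frac_integral a \<alpha> (h n) t) (frac_integral a \<alpha> g t) \<le> C / real (Suc n)" if t: "t \<in> {a..b}" for n t
    proof -
      have "norm (frac_integral a \<alpha> (\<lambda>t. g t - h n t) t) \<le> 1 / real (Suc n) * C"
        unfolding C_def by (intro norm_frac_integral_le' continuous_intros g h t \<alpha>)
      then show ?thesis
        using frac_integral_diff[OF g h(1), of t \<alpha> n] t \<alpha> by (simp add: dist_norm norm_minus_commute)
    qed
    have "uniform_limit {a..b} (\<lambda>n. frac_integral a \<alpha> (h n)) (frac_integral a \<alpha> g) sequentially"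
    proof (rule uniform_limitI)
      fix e :: real assume "e > 0"
      have "(\<lambda>n. C / real (Suc n)) \<longlonglongrightarrow> 0"
        by (rule LIMSEQ_Suc) (rule lim_const_over_n)
      then have "\<forall>\<^sub>F n in sequentially. C / real (Suc n) < e"
        using \<open>e > 0\<close> by (rule order_tendstoD)
      then show "\<forall>\<^sub>F n in sequentially. \<forall>t\<in>{a..b}. dist (frac_integral a \<alpha> (h n) t) (frac_integral a \<alpha> g t) < e"
        by eventually_elim (use le in \<open>fastforce intro: le_less_trans\<close>)
    qed
    then show "continuous_on {a..b} (frac_integral a \<alpha> g)"
      by (rule uniform_limit_theorem[rotated]) (simp_all add: h)
  qed
qed

text \<open>On a monomial the factor Gamma(\<beta> + k + 1) produced by the inner integral cancels
  against the outer one. Both sides are linear and bounded for the supremum norm, which carries the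
  identity to all continuous functions.\<close>

lemma frac_integral_semigroup:
  fixes f :: "real \<Rightarrow> 'x::banach"
  assumes ab: "a < b" and f: "continuous_on {a..b} f" and \<alpha>: "\<alpha> \<ge> 0" and \<beta>: "\<beta> \<ge> 0" and t: "t \<in> {a..b}"
  shows "frac_integral a \<alpha> (frac_integral a \<beta> f) t = frac_integral a (\<alpha> + \<beta>) f t"
proof (cases "\<alpha> = 0 \<or> \<beta> = 0")
  case True
  then show ?thesis by (auto simp: frac_integral_def cong: if_cong)
next
  case False
  then have \<alpha>: "\<alpha> > 0" and \<beta>: "\<beta> > 0" using \<alpha> \<beta> by auto
  define C where "C r = (b - a) powr r / Gamma (r + 1)" for r
  have C: "C r \<ge> 0" if "r > 0" for r using that Gamma_real_pos[of "r + 1"] by (simp add: C_def)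
  \<comment> \<open>D bounds the difference of the two sides for a function of supremum norm at most
    1.\<close>
  define D where "D = C \<beta> * C \<alpha> + C (\<alpha> + \<beta>)"
  have bound: "norm (frac_integral a r g s) \<le> B * C r"
    if "continuous_on {a..b} g" "\<And>s. s \<in> {a..b} \<Longrightarrow> norm (g s) \<le> B" "s \<in> {a..b}" "r > 0"
    for r B s and g :: "real \<Rightarrow> 'x"
    unfolding C_def using that by (rule norm_frac_integral_le')
  note cont = continuous_on_frac_integral[OF ab]
  have "\<forall>t\<in>{a..b}. frac_integral a \<alpha> (frac_integral a \<beta> f) t = frac_integral a (\<alpha> + \<beta>) f t"
  proof (rule continuous_on_monomial_induct[OF ab f], safe)
    fix k t and v :: 'x
    assume t: "t \<in> {a..b}"
    let ?c = "fact k / Gamma (\<beta> + real k + 1)"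
    have nz: "Gamma (\<beta> + real k + 1) \<noteq> 0"
      using \<beta> Gamma_real_pos[of "\<beta> + real k + 1"] by (metis add_pos_nonneg add_pos_pos less_irrefl of_nat_0_le_iff zero_less_one)
    have "frac_integral a \<alpha> (frac_integral a \<beta> (\<lambda>s. (s - a) ^ k *\<^sub>R v)) t =
        frac_integral a \<alpha> (\<lambda>s. ?c *\<^sub>R (s - a) powr (\<beta> + real k) *\<^sub>R v) t"
      using t \<beta> by (intro frac_integral_cong) (auto simp: frac_integral_power)
    also have "\<dots> = ?c *\<^sub>R (Gamma (\<beta> + real k + 1) / Gamma (\<alpha> + (\<beta> + real k) + 1) * (t - a) powr (\<alpha> + (\<beta> + real k))) *\<^sub>R v"
      using t \<alpha> \<beta> by (simp only: frac_integral_scaleR) (simp add: frac_integral_powr)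
    also have "?c *\<^sub>R (Gamma (\<beta> + real k + 1) / Gamma (\<alpha> + (\<beta> + real k) + 1) * (t - a) powr (\<alpha> + (\<beta> + real k))) *\<^sub>R v
        = (fact k / Gamma (\<alpha> + \<beta> + real k + 1) * (t - a) powr (\<alpha> + \<beta> + real k)) *\<^sub>R v"
      using nz by (simp add: add.assoc)
    also have "\<dots> = frac_integral a (\<alpha> + \<beta>) (\<lambda>s. (s - a) ^ k *\<^sub>R v) t"
      using t \<alpha> \<beta> by (simp add: frac_integral_power)
    finally show "frac_integral a \<alpha> (frac_integral a \<beta> (\<lambda>s. (s - a) ^ k *\<^sub>R v)) t =
      frac_integral a (\<alpha> + \<beta>) (\<lambda>s. (s - a) ^ k *\<^sub>R v) t" .
  next
    fix g h :: "real \<Rightarrow> 'x" and t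
    assume g: "continuous_on {a..b} g" and h: "continuous_on {a..b} h" and t: "t \<in> {a..b}"
      and IH: "\<forall>t\<in>{a..b}. frac_integral a \<alpha> (frac_integral a \<beta> g) t = frac_integral a (\<alpha> + \<beta>) g t"
        "\<forall>t\<in>{a..b}. frac_integral a \<alpha> (frac_integral a \<beta> h) t = frac_integral a (\<alpha> + \<beta>) h t"
    have "frac_integral a \<alpha> (frac_integral a \<beta> (\<lambda>s. g s + h s)) t =
        frac_integral a \<alpha> (\<lambda>s. frac_integral a \<beta> g s + frac_integral a \<beta> h s) t"
      using t \<beta> frac_integral_add[OF g h] by (intro frac_integral_cong) auto
    also have "\<dots> = frac_integral a \<alpha> (frac_integral a \<beta> g) t + frac_integral a \<alpha> (frac_integral a \<beta> h) t"
      using t \<alpha> \<beta> by (intro frac_integral_add[where b=b] cont g h) auto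
    also have "\<dots> = frac_integral a (\<alpha> + \<beta>) (\<lambda>s. g s + h s) t"
      using t \<alpha> \<beta> IH frac_integral_add[OF g h, of t "\<alpha> + \<beta>"] by auto
    finally show "frac_integral a \<alpha> (frac_integral a \<beta> (\<lambda>s. g s + h s)) t = frac_integral a (\<alpha> + \<beta>) (\<lambda>s. g s + h s) t" .
  next
    fix g :: "real \<Rightarrow> 'x" and t
    assume g: "continuous_on {a..b} g" and t: "t \<in> {a..b}"
      and ex: "\<And>e. e > 0 \<Longrightarrow> \<exists>h. continuous_on {a..b} h \<and>
        (\<forall>t\<in>{a..b}. frac_integral a \<alpha> (frac_integral a \<beta> h) t = frac_integral a (\<alpha> + \<beta>) h t) \<and>
        (\<forall>t\<in>{a..b}. norm (g t - h t) \<le> e)"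
    let ?d = "frac_integral a \<alpha> (frac_integral a \<beta> g) t - frac_integral a (\<alpha> + \<beta>) g t"
    \<comment> \<open>The identity holds for h, so the defect of g equals the defect of g - h, a
      function of supremum norm at most e.\<close>
    have le: "norm ?d \<le> e * D" if e: "e > 0" for e
    proof -
      obtain h where h: "continuous_on {a..b} h" "\<And>t. t \<in> {a..b} \<Longrightarrow> norm (g t - h t) \<le> e"
        "frac_integral a \<alpha> (frac_integral a \<beta> h) t = frac_integral a (\<alpha> + \<beta>) h t"
        using ex[OF e] t by auto
      let ?u = "\<lambda>s. g s - h s"
      have u: "continuous_on {a..b} ?u" by (intro continuous_intros g h)
      have "frac_integral a \<alpha> (frac_integral a \<beta> ?u) t =
          frac_integral a \<alpha> (\<lambda>s. frac_integral a \<beta> g s - frac_integral a \<beta> h s) t"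
        using t \<beta> frac_integral_diff[OF g h(1)] by (intro frac_integral_cong) auto
      also have "\<dots> = frac_integral a \<alpha> (frac_integral a \<beta> g) t - frac_integral a \<alpha> (frac_integral a \<beta> h) t"
        using t \<alpha> \<beta> by (intro frac_integral_diff[where b=b] cont g h) auto
      finally have "?d = frac_integral a \<alpha> (frac_integral a \<beta> ?u) t - frac_integral a (\<alpha> + \<beta>) ?u t"
        using frac_integral_diff[OF g h(1), of t "\<alpha> + \<beta>"] t \<alpha> \<beta> h(3) by simp
      also have "norm \<dots> \<le> norm (frac_integral a \<alpha> (frac_integral a \<beta> ?u) t) + norm (frac_integral a (\<alpha> + \<beta>) ?u t)"
        by (rule norm_triangle_ineq4)
      also have "\<dots> \<le> (e * C \<beta>) * C \<alpha> + e * C (\<alpha> + \<beta>)"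
        using t \<alpha> \<beta> by (intro add_mono bound cont u h) auto
      finally show ?thesis by (simp add: D_def algebra_simps)
    qed
    have D: "D \<ge> 0" using C \<alpha> \<beta> by (simp add: D_def)
    have "norm ?d \<le> e" if "e > 0" for e
    proof -
      \<comment> \<open>Division by D + 1 instead of D keeps the denominator positive.\<close>
      have "norm ?d \<le> e / (D + 1) * D" using D that by (intro le) auto
      also have "\<dots> \<le> e" using D that by (simp add: field_simps)
      finally show ?thesis .
    qed
    then have "norm ?d \<le> 0" by (rule field_le_epsilon[of _ 0, simplified])
    then show "frac_integral a \<alpha> (frac_integral a \<beta> g) t = frac_integral a (\<alpha> + \<beta>) g t" by simp
  qed
  then show ?thesis using t by blast
qed

lemma frac_integral_1:
  "frac_integral a 1 f t = integral {a..t} f"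
  \<comment> \<open>The kernel (t - s) powr 0 is 1 except at s = t, where it is 0.\<close>
  unfolding frac_integral_def by (simp, rule integral_spike[of "{t}"]) auto

text \<open>By the semigroup law J^(\<alpha>+1) f is the ordinary integral of the continuous
  function J^\<alpha> f, so the fundamental theorem of calculus applies and no differentiation under
  the integral sign is involved.\<close>

lemma frac_integral_has_vector_derivative:
  fixes f :: "real \<Rightarrow> 'x::banach"
  assumes ab: "a < b" and f: "continuous_on {a..b} f" and \<alpha>: "\<alpha> \<ge> 0" and t: "t \<in> {a..b}"
  shows "(frac_integral a (\<alpha> + 1) f has_vector_derivative frac_integral a \<alpha> f t) (at t within {a..b})"
proof -
  have "((\<lambda>u. integral {a..u} (frac_integral a \<alpha> f)) has_vector_derivative frac_integral a \<alpha> f t) (at t within {a..b})"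
    by (intro integral_has_vector_derivative continuous_on_frac_integral assms)
  moreover have "frac_integral a (\<alpha> + 1) f u = integral {a..u} (frac_integral a \<alpha> f)" if "u \<in> {a..b}" for u
    using frac_integral_semigroup[OF ab f, of 1 \<alpha> u] that \<alpha> by (simp add: frac_integral_1 add.commute)
  ultimately show ?thesis
    using t by (auto intro: has_vector_derivative_transform)
qed

section \<open>Test functions and weak derivatives\<close>

definition smooth :: "(real \<Rightarrow> real) \<Rightarrow> bool" where
  "smooth f \<longleftrightarrow> (\<forall>k t. (deriv ^^ k) f field_differentiable at t)"

text \<open>Bounding the order permits induction: the derivative of a product is a sum of products
  whose factors are differentiable up to one order less.\<close>

lemma smooth_iff_upto: "smooth f \<longleftrightarrow> (\<forall>k. \<forall>j\<le>k. \<forall>t. (deriv ^^ j) f field_differentiable at t)"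
  unfolding smooth_def by blast

lemma differentiable_upto_Suc:
  "(\<forall>j\<le>Suc k. \<forall>t. (deriv ^^ j) f field_differentiable at t) \<longleftrightarrow>
    (\<forall>t. f field_differentiable at t) \<and> (\<forall>j\<le>k. \<forall>t. (deriv ^^ j) (deriv f) field_differentiable at t)"
    (is "?L \<longleftrightarrow> ?R")
proof
  assume L: ?L
  have "(deriv ^^ j) (deriv f) field_differentiable at t" if "j \<le> k" for j t
    using L[rule_format, of "Suc j" t] that by (simp add: funpow_swap1)
  then show ?R using L[rule_format, of 0] by simp
next
  assume R: ?R
  show ?L
  proof (intro allI impI)
    fix j t assume "j \<le> Suc k"
    then show "(deriv ^^ j) f field_differentiable at t"
      using R by (cases j) (auto simp: funpow_swap1)
  qed
qed

lemma differentiable_upto_add: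
  fixes f g :: "real \<Rightarrow> real"
  assumes "\<forall>j\<le>k. \<forall>t. (deriv ^^ j) f field_differentiable at t" "\<forall>j\<le>k. \<forall>t. (deriv ^^ j) g field_differentiable at t"
  shows "\<forall>j\<le>k. \<forall>t. (deriv ^^ j) (\<lambda>t. f t + g t) field_differentiable at t"
  using assms
proof (induction k arbitrary: f g)
  case 0
  then show ?case by (auto intro: field_differentiable_add)
next
  case (Suc k)
  have d: "\<forall>t. f field_differentiable at t" "\<forall>t. g field_differentiable at t"
    using Suc.prems unfolding differentiable_upto_Suc by auto
  then have "deriv (\<lambda>t. f t + g t) = (\<lambda>t. deriv f t + deriv g t)"
    by (intro ext deriv_add) auto
  then show ?case
    using Suc unfolding differentiable_upto_Suc by (auto intro: field_differentiable_add)
qed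

lemma differentiable_upto_mult:
  fixes f g :: "real \<Rightarrow> real"
  assumes "\<forall>j\<le>k. \<forall>t. (deriv ^^ j) f field_differentiable at t" "\<forall>j\<le>k. \<forall>t. (deriv ^^ j) g field_differentiable at t"
  shows "\<forall>j\<le>k. \<forall>t. (deriv ^^ j) (\<lambda>t. f t * g t) field_differentiable at t"
  using assms
proof (induction k arbitrary: f g)
  case 0
  then show ?case by (auto intro: field_differentiable_mult)
next
  case (Suc k)
  have d: "\<forall>t. f field_differentiable at t" "\<forall>t. g field_differentiable at t"
    using Suc.prems unfolding differentiable_upto_Suc by auto
  then have "deriv (\<lambda>t. f t * g t) = (\<lambda>t. f t * deriv g t + deriv f t * g t)"
    by (intro ext deriv_mult) auto
  moreover have "\<forall>j\<le>k. \<forall>t. (deriv ^^ j) (\<lambda>t. f t * deriv g t + deriv f t * g t) field_differentiable at t"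
    using Suc.prems unfolding differentiable_upto_Suc
    by (intro differentiable_upto_add Suc.IH) (auto simp: Suc.prems le_SucI)
  ultimately show ?case
    using d unfolding differentiable_upto_Suc by (auto intro: field_differentiable_mult)
qed

lemma smooth_add: "smooth f \<Longrightarrow> smooth g \<Longrightarrow> smooth (\<lambda>t. f t + g t)"
  unfolding smooth_iff_upto by (intro allI[of "\<lambda>k. \<forall>j\<le>k. _ k j"] differentiable_upto_add) auto

lemma smooth_mult: "smooth f \<Longrightarrow> smooth g \<Longrightarrow> smooth (\<lambda>t. f t * g t)"
  unfolding smooth_iff_upto by (intro allI[of "\<lambda>k. \<forall>j\<le>k. _ k j"] differentiable_upto_mult) auto

lemma smooth_deriv: "smooth f \<Longrightarrow> smooth (deriv f)"
  unfolding smooth_def by (metis funpow_swap1 funpow.simps(2) o_apply)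

lemma smooth_of_deriv: "(\<And>t. f field_differentiable at t) \<Longrightarrow> smooth (deriv f) \<Longrightarrow> smooth f"
  unfolding smooth_iff_upto
  using differentiable_upto_Suc[of _ f] by (metis le_SucI)

text \<open>Supplies translations, reflections and multiples of a smooth function. The closed form
  of the k-th derivative, with its factor m^k, carries the induction.\<close>

lemma smooth_affine:
  assumes "smooth f"
  shows "smooth (\<lambda>t. A * f (m * t + c))"
proof -
  have "(deriv ^^ k) (\<lambda>t. A * f (m * t + c)) = (\<lambda>t. A * m ^ k * (deriv ^^ k) f (m * t + c)) \<and>
      (\<forall>t. (\<lambda>t. A * m ^ k * (deriv ^^ k) f (m * t + c)) field_differentiable at t)" for k
  proof -
    have D: "((\<lambda>t. B * (deriv ^^ k) f (m * t + c)) has_field_derivative B * m * (deriv ^^ Suc k) f (m * t + c)) (at t)" for B k t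
    proof -
      have "((deriv ^^ k) f has_field_derivative deriv ((deriv ^^ k) f) (m * t + c)) (at (m * t + c))"
        using assms unfolding smooth_def by (intro field_differentiable_derivI) blast
      then have "((\<lambda>t. (deriv ^^ k) f (m * t + c)) has_field_derivative deriv ((deriv ^^ k) f) (m * t + c) * m) (at t)"
        by (rule DERIV_chain2) (auto intro!: derivative_eq_intros)
      from DERIV_cmult[OF this, of B] show ?thesis by (simp add: mult_ac)
    qed
    have "(deriv ^^ k) (\<lambda>t. A * f (m * t + c)) = (\<lambda>t. A * m ^ k * (deriv ^^ k) f (m * t + c))"
    proof (induction k)
      case (Suc k)
      have "(deriv ^^ Suc k) (\<lambda>t. A * f (m * t + c)) = deriv (\<lambda>t. A * m ^ k * (deriv ^^ k) f (m * t + c))"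
        by (simp only: funpow.simps o_apply Suc.IH)
      also have "\<dots> = (\<lambda>t. A * m ^ Suc k * (deriv ^^ Suc k) f (m * t + c))"
        using DERIV_imp_deriv[OF D[of "A * m ^ k" k]] by (simp add: mult_ac fun_eq_iff)
      finally show ?case .
    qed simp
    then show ?thesis using D[of "A * m ^ k" k] unfolding field_differentiable_def by blast
  qed
  then show ?thesis unfolding smooth_def by simp
qed

text \<open>The family is closed under differentiation thanks to its polynomial factor.\<close>

definition exp_bump :: "real poly \<Rightarrow> real \<Rightarrow> real" where
  "exp_bump p x = (if x > 0 then poly p (1 / x) * exp (- 1 / x) else 0)"

lemma tendsto_poly_div_exp_0: "((\<lambda>x. poly p x / exp x) \<longlongrightarrow> 0) at_top"
  for p :: "real poly"
proof -
  have "((\<lambda>x. \<Sum>i\<le>degree p. coeff p i * (x ^ i / exp x)) \<longlongrightarrow> (\<Sum>i\<le>degree p. coeff p i * 0)) at_top"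
    by (intro tendsto_sum tendsto_mult tendsto_const tendsto_power_div_exp_0)
  then show ?thesis by (simp add: poly_altdef sum_divide_distrib)
qed

text \<open>With y = 1/x, differentiating p(y) exp(-y) gives (p(y) - p'(y)) y^2 exp(-y), whence the
  factor \<open>[:0, 0, 1:]\<close>. At x = 0 the difference quotient from the right is y p(y) / exp
  y, which tends to 0 as y tends to infinity.\<close>

lemma exp_bump_has_field_derivative:
  "(exp_bump p has_field_derivative exp_bump ((p - pderiv p) * [:0, 0, 1:]) x) (at x)"
proof -
  consider "x > 0" | "x < 0" | "x = 0" by linarith
  then show ?thesis
  proof cases
    case 1
    have "((\<lambda>x. poly p (1 / x) * exp (- 1 / x)) has_field_derivative
        exp_bump ((p - pderiv p) * [:0, 0, 1:]) x) (at x)"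
      using 1 by (auto intro!: derivative_eq_intros poly_DERIV[THEN DERIV_chain2]
          simp: exp_bump_def field_simps power2_eq_square)
    then show ?thesis
      by (rule has_field_derivative_transform_within_open[where S="{0<..}"]) (use 1 in \<open>auto simp: exp_bump_def\<close>)
  next
    case 2
    have "((\<lambda>x. 0) has_field_derivative exp_bump ((p - pderiv p) * [:0, 0, 1:]) x) (at x)"
      using 2 by (simp add: exp_bump_def)
    then show ?thesis
      by (rule has_field_derivative_transform_within_open[where S="{..<0}"]) (use 2 in \<open>auto simp: exp_bump_def\<close>)
  next
    case 3
    have "((\<lambda>h. exp_bump p h / h) \<longlongrightarrow> 0) (at 0)"
    proof (rule filterlim_split_at)
      show "((\<lambda>h. exp_bump p h / h) \<longlongrightarrow> 0) (at_left 0)"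
        by (rule tendsto_eventually) (auto simp: exp_bump_def eventually_at_left_field intro: exI[of _ "-1"])
      have "((\<lambda>y. poly (p * [:0, 1:]) y / exp y) \<longlongrightarrow> 0) at_top"
        by (rule tendsto_poly_div_exp_0)
      then have "((\<lambda>y. exp_bump p (inverse y) / inverse y) \<longlongrightarrow> 0) at_top"
        by (rule Lim_transform_eventually)
          (rule eventually_mono[OF eventually_gt_at_top[of 0]], auto simp: exp_bump_def field_simps exp_minus)
      then show "((\<lambda>h. exp_bump p h / h) \<longlongrightarrow> 0) (at_right 0)"
        by (simp add: filterlim_at_right_to_top)
    qed
    then show ?thesis using 3 by (simp add: DERIV_def exp_bump_def)
  qed
qed

lemma smooth_exp_bump: "smooth (exp_bump p)"
proof -
  have "\<exists>q. (deriv ^^ k) (exp_bump p) = exp_bump q" for k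
  proof (induction k)
    case (Suc k)
    then obtain q where "(deriv ^^ k) (exp_bump p) = exp_bump q" by blast
    moreover have "deriv (exp_bump q) = exp_bump ((q - pderiv q) * [:0, 0, 1:])"
      using DERIV_imp_deriv[OF exp_bump_has_field_derivative] by blast
    ultimately show ?case by auto
  qed auto
  then show ?thesis
    unfolding smooth_def field_differentiable_def by (metis exp_bump_has_field_derivative)
qed

section \<open>Construction of test functions\<close>

lemma test_functionI:
  assumes "smooth \<phi>" "a < c" "d < b" "\<And>t. t \<notin> {c..d} \<Longrightarrow> \<phi> t = 0"
  shows "test_function a b \<phi>"
proof -
  have sub: "closure {t. \<phi> t \<noteq> 0} \<subseteq> {c..d}"
    using assms(4) by (intro closure_minimal subsetI) (blast, simp)
  then have "compact (closure {t. \<phi> t \<noteq> 0})"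
    by (metis bounded_closed_interval bounded_subset closed_closure compact_eq_bounded_closed)
  then show ?thesis
    using assms sub unfolding test_function_def smooth_def by fastforce
qed

text \<open>Leaves a margin between the support and the end points a and b. The open interval in the
  conclusion yields vanishing at c and d themselves, which the antiderivative below uses.\<close>

lemma test_functionE:
  assumes "test_function a b \<phi>" "a < b"
  obtains c d where "a < c" "c < d" "d < b" "\<And>t. t \<notin> {c<..<d} \<Longrightarrow> \<phi> t = 0"
proof -
  let ?C = "closure {t. \<phi> t \<noteq> 0}"
  have C: "compact ?C" "?C \<subseteq> {a<..<b}" using assms by (auto simp: test_function_def)
  \<comment> \<open>For \<phi> = 0 the support is empty and has no extreme points; any point of (a,
    b) then serves as both bounds.\<close>
  have "\<exists>c0 d0. a < c0 \<and> c0 \<le> d0 \<and> d0 < b \<and> ?C \<subseteq> {c0..d0}"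
  proof (cases "?C = {}")
    case True
    then show ?thesis using assms(2) dense[of a b] by auto
  next
    case False
    obtain s where s: "s \<in> ?C" "\<And>t. t \<in> ?C \<Longrightarrow> s \<le> t" using compact_attains_inf[OF C(1) False] by blast
    obtain S where S: "S \<in> ?C" "\<And>t. t \<in> ?C \<Longrightarrow> t \<le> S" using compact_attains_sup[OF C(1) False] by blast
    show ?thesis using s S C(2) by (intro exI[of _ s] exI[of _ S]) auto
  qed
  then obtain c0 d0 where cd: "a < c0" "c0 \<le> d0" "d0 < b" "?C \<subseteq> {c0..d0}" by blast
  obtain c where c: "a < c" "c < c0" using dense[OF cd(1)] by blast
  obtain d where d: "d0 < d" "d < b" using dense[OF cd(3)] by blast
  show ?thesis
  proof (rule that[of c d])
    fix t assume t: "t \<notin> {c<..<d}"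
    then have "t \<notin> ?C" using cd(4) c d by auto
    then show "\<phi> t = 0" using closure_subset[of "{t. \<phi> t \<noteq> 0}"] by blast
  qed (use c d cd in auto)
qed

lemma test_function_smooth: "test_function a b \<phi> \<Longrightarrow> smooth \<phi>"
  by (simp add: test_function_def smooth_def)

lemma test_function_deriv:
  assumes "test_function a b \<phi>" "a < b"
  shows "test_function a b (deriv \<phi>)"
proof -
  obtain c d where cd: "a < c" "c < d" "d < b" "\<And>t. t \<notin> {c<..<d} \<Longrightarrow> \<phi> t = 0"
    using test_functionE[OF assms] by blast
  have "deriv \<phi> t = 0" if "t \<notin> {c..d}" for t
  proof -
    have "((\<lambda>_. 0) has_field_derivative 0) (at t)" by simp
    then have "(\<phi> has_field_derivative 0) (at t)"
      by (rule has_field_derivative_transform_within_open[where S="- {c..d}"]) (use that cd(4) in auto)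
    then show ?thesis by (rule DERIV_imp_deriv)
  qed
  then show ?thesis
    using cd smooth_deriv[OF test_function_smooth[OF assms(1)]] by (intro test_functionI[of _ _ c d]) auto
qed

lemma test_function_derivs:
  assumes "test_function a b \<phi>" "a < b"
  shows "test_function a b ((deriv ^^ k) \<phi>)"
  using assms by (induction k) (auto intro: test_function_deriv)

lemma test_function_has_derivative:
  "test_function a b \<phi> \<Longrightarrow> (\<phi> has_field_derivative deriv \<phi> t) (at t)"
  using test_function_smooth[of a b \<phi>] unfolding smooth_def
  by (intro field_differentiable_derivI) (metis funpow_0)

lemma test_function_continuous: "test_function a b \<phi> \<Longrightarrow> continuous_on S \<phi>"
  by (rule DERIV_continuous_on) (rule has_field_derivative_at_within[OF test_function_has_derivative])

lemma test_function_linear: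
  assumes "test_function a b \<phi>" "test_function a b \<psi>" "a < b"
  shows "test_function a b (\<lambda>t. \<phi> t + r * \<psi> t)"
proof -
  obtain c d where cd: "a < c" "c < d" "d < b" "\<And>t. t \<notin> {c<..<d} \<Longrightarrow> \<phi> t = 0"
    using test_functionE[OF assms(1,3)] by blast
  obtain c' d' where cd': "a < c'" "c' < d'" "d' < b" "\<And>t. t \<notin> {c'<..<d'} \<Longrightarrow> \<psi> t = 0"
    using test_functionE[OF assms(2,3)] by blast
  have "smooth (\<lambda>t. \<phi> t + r * \<psi> t)"
    using smooth_add[OF test_function_smooth[OF assms(1)] smooth_affine[OF test_function_smooth[OF assms(2)], of r 1 0]]
    by simp
  moreover have "\<phi> t + r * \<psi> t = 0" if "t \<notin> {min c c'..max d d'}" for t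
  proof -
    have "\<phi> t = 0" by (rule cd(4)) (use that in auto)
    moreover have "\<psi> t = 0" by (rule cd'(4)) (use that in auto)
    ultimately show ?thesis by simp
  qed
  ultimately show ?thesis
    using cd(1-3) cd'(1-3) by (intro test_functionI[of _ _ "min c c'" "max d d'"]) auto
qed

lemma deriv_funpow_linear:
  assumes "smooth f" "smooth g"
  shows "(deriv ^^ k) (\<lambda>t. f t + r * g t) = (\<lambda>t. (deriv ^^ k) f t + r * (deriv ^^ k) g t)"
proof (induction k)
  case (Suc k)
  have "deriv (\<lambda>t. (deriv ^^ k) f t + r * (deriv ^^ k) g t) t = deriv ((deriv ^^ k) f) t + r * deriv ((deriv ^^ k) g) t" for t
    using assms unfolding smooth_def
    by (intro DERIV_imp_deriv DERIV_add DERIV_cmult field_differentiable_derivI) auto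
  then show ?case by (simp add: Suc.IH fun_eq_iff)
qed simp

text \<open>Beyond the support of \<eta> the primitive from a is constant, and that constant is the
  total integral of \<eta>. Zero mean is therefore what gives the primitive compact support.\<close>

lemma test_function_antiderivative:
  assumes \<eta>: "test_function a b \<eta>" and ab: "a < b" and 0: "integral {a..b} \<eta> = 0"
  shows "\<exists>\<phi>. test_function a b \<phi> \<and> deriv \<phi> = \<eta>"
proof -
  obtain c d where cd: "a < c" "c < d" "d < b" "\<And>t. t \<notin> {c<..<d} \<Longrightarrow> \<eta> t = 0"
    using test_functionE[OF \<eta> ab] by blast
  define \<phi> where "\<phi> t = integral {a..t} \<eta>" for t
  have int: "\<eta> integrable_on {s..t}" for s t
    by (intro integrable_continuous_real test_function_continuous[OF \<eta>])
  have small: "\<phi> t = 0" if "t \<le> c" for t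
    unfolding \<phi>_def by (rule integral_unique, rule has_integral_is_0) (use that cd in auto)
  have const: "\<phi> t = \<phi> d" if "t \<ge> d" for t
  proof -
    have "\<phi> t = \<phi> d + integral {d..t} \<eta>"
      unfolding \<phi>_def using that cd int by (intro Henstock_Kurzweil_Integration.integral_combine[symmetric]) auto
    also have "integral {d..t} \<eta> = 0"
      by (rule integral_unique, rule has_integral_is_0) (use that cd in auto)
    finally show ?thesis by simp
  qed
  have "\<phi> b = 0" using 0 by (simp add: \<phi>_def)
  then have large: "\<phi> t = 0" if "t \<ge> d" for t
    using const[OF that] const[of b] cd by simp
  \<comment> \<open>The derivative is needed on the whole line. Left of c the primitive is locally
    0; from c on, t is an interior point of {a..t+1}, where the fundamental theorem of calculus
    applies.\<close>
  have D: "(\<phi> has_field_derivative \<eta> t) (at t)" for t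
  proof (cases "t < c")
    case True
    have "((\<lambda>_. 0) has_field_derivative \<eta> t) (at t)" using cd(4)[of t] True by simp
    then show ?thesis
      by (rule has_field_derivative_transform_within_open[where S="{..<c}"]) (use True small in auto)
  next
    case False
    have "(\<phi> has_vector_derivative \<eta> t) (at t within {a..t+1})"
      unfolding \<phi>_def using False cd
      by (intro integral_has_vector_derivative test_function_continuous[OF \<eta>]) auto
    moreover have "at t within {a..t+1} = at t"
      using False cd by (intro at_within_Icc_at) auto
    ultimately show ?thesis by (simp add: has_real_derivative_iff_has_vector_derivative)
  qed
  then have deriv: "deriv \<phi> = \<eta>" by (auto intro: DERIV_imp_deriv)
  have "smooth \<phi>"
  proof (rule smooth_of_deriv)
    show "\<phi> field_differentiable at t" for t using D[of t] unfolding field_differentiable_def by blast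
    show "smooth (deriv \<phi>)" unfolding deriv by (rule test_function_smooth[OF \<eta>])
  qed
  then have "test_function a b \<phi>"
    using cd small large by (intro test_functionI[of _ _ c d]) auto
  with deriv show ?thesis by blast
qed

text \<open>The product of a one-sided bump at c and a reflected one at d. Its integral is nonzero
  since otherwise a continuous nonnegative function would vanish at the midpoint, so it can be
  normalised.\<close>

lemma test_function_bump:
  assumes "a < c" "c < d" "d < b"
  obtains \<psi> where "test_function a b \<psi>" "\<And>t. \<psi> t \<ge> 0" "\<And>t. t \<notin> {c..d} \<Longrightarrow> \<psi> t = 0"
    "integral {a..b} \<psi> = 1"
proof -
  define \<psi> where "\<psi> t = exp_bump 1 (t - c) * exp_bump 1 (d - t)" for t
  have "smooth (\<lambda>t. (1 * exp_bump 1 (1 * t + - c)) * (1 * exp_bump 1 ((- 1) * t + d)))"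
    by (intro smooth_mult smooth_affine smooth_exp_bump)
  then have sm: "smooth \<psi>" by (simp add: \<psi>_def[abs_def] algebra_simps)
  have nn: "\<psi> t \<ge> 0" for t by (simp add: \<psi>_def exp_bump_def)
  have z: "\<psi> t = 0" if "t \<notin> {c..d}" for t using that by (auto simp: \<psi>_def exp_bump_def)
  have test: "test_function a b \<psi>" using assms sm z by (intro test_functionI[of _ _ c d])
  have int: "\<psi> integrable_on {a..b}"
    by (intro integrable_continuous_real test_function_continuous[OF test])
  have "integral {a..b} \<psi> \<noteq> 0"
  proof
    assume "integral {a..b} \<psi> = 0"
    then have "(\<psi> has_integral 0) (cbox a b)" using int by (metis cbox_interval has_integral_integral)
    then have "\<psi> ((c + d) / 2) = 0"
      using nn assms
      by (intro has_integral_0_cbox_imp_0[of a b \<psi>] test_function_continuous[OF test]) auto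
    then show False using assms by (simp add: \<psi>_def exp_bump_def)
  qed
  define I where "I = integral {a..b} \<psi>"
  have I: "I > 0"
    using \<open>integral {a..b} \<psi> \<noteq> 0\<close> integral_nonneg[OF int] nn by (auto simp: I_def less_le)
  show ?thesis
  proof (rule that[of "\<lambda>t. (1 / I) * \<psi> t"])
    have "smooth (\<lambda>t. (1 / I) * \<psi> t)" using smooth_affine[OF sm, of "1 / I" 1 0] by simp
    then show "test_function a b (\<lambda>t. (1 / I) * \<psi> t)"
      using assms z by (intro test_functionI[of _ _ c d]) auto
    show "integral {a..b} (\<lambda>t. (1 / I) * \<psi> t) = 1"
      using I int by (simp add: I_def)
  qed (use I nn z in auto)
qed


section \<open>Integration by parts and du Bois-Reymond's lemma\<close>

lemma integral_deriv_test_function: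
  fixes u :: "real \<Rightarrow> 'x::banach"
  assumes \<phi>: "test_function a b \<phi>" and ab: "a < b"
    and u: "\<And>t. t \<in> {a..b} \<Longrightarrow> (u has_vector_derivative u' t) (at t within {a..b})"
    and u': "continuous_on {a..b} u'"
  shows "integral {a..b} (\<lambda>t. deriv \<phi> t *\<^sub>R u t) = - integral {a..b} (\<lambda>t. \<phi> t *\<^sub>R u' t)"
proof -
  obtain c d where "a < c" "c < d" "d < b" "\<And>t. t \<notin> {c<..<d} \<Longrightarrow> \<phi> t = 0"
    using test_functionE[OF \<phi> ab] by blast
  then have z: "\<phi> a = 0" "\<phi> b = 0" by auto
  have "((\<lambda>t. deriv \<phi> t *\<^sub>R u t) has_integral - integral {a..b} (\<lambda>t. \<phi> t *\<^sub>R u' t)) {a..b}"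
  proof (rule integration_by_parts_interior[OF bounded_bilinear_scaleR, where f=\<phi> and g=u and g'=u'])
    show "continuous_on {a..b} u"
      using u has_vector_derivative_continuous continuous_on_eq_continuous_within by blast
    show "(\<phi> has_vector_derivative deriv \<phi> x) (at x)" for x
      using test_function_has_derivative[OF \<phi>] by (simp add: has_real_derivative_iff_has_vector_derivative)
    show "(u has_vector_derivative u' x) (at x)" if "x \<in> {a<..<b}" for x
      using u[of x] that at_within_Icc_at[of a x b] by auto
    have "(\<lambda>t. \<phi> t *\<^sub>R u' t) integrable_on {a..b}"
      by (intro integrable_continuous_real continuous_intros u' test_function_continuous[OF \<phi>])
    then show "((\<lambda>x. \<phi> x *\<^sub>R u' x) has_integral
        \<phi> b *\<^sub>R u b - \<phi> a *\<^sub>R u a - - integral {a..b} (\<lambda>t. \<phi> t *\<^sub>R u' t)) {a..b}"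
      using z by (simp add: integrable_integral)
  qed (use ab test_function_continuous[OF \<phi>] in auto)
  then show ?thesis by (rule integral_unique)
qed

text \<open>Derivatives are given as a tower F instead of being taken of one function. The same
  statement then serves both \<open>higher_deriv_on\<close> and fractional integrals of decreasing
  order.\<close>

lemma integral_derivs_test_function:
  fixes F :: "nat \<Rightarrow> real \<Rightarrow> 'x::banach"
  assumes "test_function a b \<phi>" and ab: "a < b"
    and "\<And>j t. j < n \<Longrightarrow> t \<in> {a..b} \<Longrightarrow> (F j has_vector_derivative F (Suc j) t) (at t within {a..b})"
    and "continuous_on {a..b} (F n)"
  shows "integral {a..b} (\<lambda>t. (deriv ^^ n) \<phi> t *\<^sub>R F 0 t) = (-1) ^ n *\<^sub>R integral {a..b} (\<lambda>t. \<phi> t *\<^sub>R F n t)"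
  using assms(1,3,4)
proof (induction n arbitrary: \<phi>)
  case (Suc n)
  have c: "continuous_on {a..b} (F n)"
    using Suc.prems(2)[of n] has_vector_derivative_continuous continuous_on_eq_continuous_within by blast
  have "integral {a..b} (\<lambda>t. (deriv ^^ n) (deriv \<phi>) t *\<^sub>R F 0 t) = (-1) ^ n *\<^sub>R integral {a..b} (\<lambda>t. deriv \<phi> t *\<^sub>R F n t)"
    using Suc.prems c by (intro Suc.IH test_function_deriv ab) auto
  also have "integral {a..b} (\<lambda>t. deriv \<phi> t *\<^sub>R F n t) = - integral {a..b} (\<lambda>t. \<phi> t *\<^sub>R F (Suc n) t)"
    using Suc.prems by (intro integral_deriv_test_function ab) auto
  finally show ?case by (simp add: funpow_swap1)
qed simp

text \<open>At an inner point p a bump of mass 1 averages w over points where it differs from w p by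
  at most half of norm (w p). The average is 0, so norm (w p) would be at most half of itself. The
  end points follow by continuity.\<close>

lemma eq_0_if_integral_test_function:
  fixes w :: "real \<Rightarrow> 'x::banach"
  assumes ab: "a < b" and w: "continuous_on {a..b} w"
    and 0: "\<And>\<phi>. test_function a b \<phi> \<Longrightarrow> integral {a..b} (\<lambda>t. \<phi> t *\<^sub>R w t) = 0"
    and t: "t \<in> {a..b}"
  shows "w t = 0"
proof -
  have "w p = 0" if p: "p \<in> {a<..<b}" for p
  proof (rule ccontr)
    assume "w p \<noteq> 0"
    define e where "e = norm (w p) / 2"
    have e: "e > 0" using \<open>w p \<noteq> 0\<close> by (simp add: e_def)
    obtain d where d: "d > 0" "\<And>x. x \<in> {a..b} \<Longrightarrow> dist x p < d \<Longrightarrow> dist (w x) (w p) < e"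
      using w p e unfolding continuous_on_iff by (metis greaterThanLessThan_subseteq_atLeastAtMost_iff order_refl subsetD)
    \<comment> \<open>Keeps p - r and p + r strictly inside (a, b) and within the continuity radius
      d.\<close>
    define r where "r = min (d / 2) (min ((p - a) / 2) ((b - p) / 2))"
    have r: "r > 0" "r < d" "a < p - r" "p + r < b"
      using d(1) p by (auto simp: r_def min_def field_simps)
    obtain \<psi> where \<psi>: "test_function a b \<psi>" "\<And>t. \<psi> t \<ge> 0" "\<And>t. t \<notin> {p-r..p+r} \<Longrightarrow> \<psi> t = 0" "integral {a..b} \<psi> = 1"
      using test_function_bump[of a "p - r" "p + r" b] r by auto
    note c = test_function_continuous[OF \<psi>(1)]
    have int: "\<psi> integrable_on {a..b}" "(\<lambda>t. \<psi> t *\<^sub>R w t) integrable_on {a..b}" "(\<lambda>t. \<psi> t *\<^sub>R w p) integrable_on {a..b}"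
      by (intro integrable_continuous_real continuous_intros c w)+
    have "((\<lambda>t. \<psi> t *\<^sub>R w p) has_integral 1 *\<^sub>R w p) {a..b}"
      using int(1) \<psi>(4) by (intro has_integral_scaleR_left) (metis integrable_integral)
    then have "w p = integral {a..b} (\<lambda>t. \<psi> t *\<^sub>R w p) - integral {a..b} (\<lambda>t. \<psi> t *\<^sub>R w t)"
      by (simp add: integral_unique 0[OF \<psi>(1)])
    also have "\<dots> = integral {a..b} (\<lambda>t. \<psi> t *\<^sub>R (w p - w t))"
      using int by (simp add: Henstock_Kurzweil_Integration.integral_diff scaleR_diff_right)
    also have "norm \<dots> \<le> integral {a..b} (\<lambda>t. \<psi> t * e)"
    proof (rule integral_norm_bound_integral)
      fix x assume x: "x \<in> {a..b}"
      show "norm (\<psi> x *\<^sub>R (w p - w x)) \<le> \<psi> x * e"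
      proof (cases "x \<in> {p-r..p+r}")
        case True
        then have "dist x p < d" using r by (auto simp: dist_real_def)
        from d(2)[OF x this] have "norm (w p - w x) \<le> e" by (simp add: dist_norm norm_minus_commute)
        then show ?thesis using \<psi>(2) by (simp add: mult_left_mono)
      qed (simp add: \<psi>(3))
    qed (intro integrable_continuous_real continuous_intros c w)+
    also have "\<dots> = e" using \<psi>(4) by simp
    finally show False using e by (simp add: e_def)
  qed
  moreover have "closure {a<..<b} = {a..b}" using ab by simp
  ultimately show ?thesis
    using continuous_constant_on_closure[of "{a<..<b}" w 0 t] w t by auto
qed

lemma frac_integral_nat_const:
  fixes v :: "'x::banach"
  assumes "a \<le> t"
  shows "frac_integral a (real n) (\<lambda>s. v) t = ((t - a) ^ n / fact n) *\<^sub>R v"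
proof (cases "n = 0")
  case False
  then show ?thesis
    using assms Gamma_fact[of n, where 'a=real] by (simp add: frac_integral_const powr_realpow' add.commute)
qed (simp add: frac_integral_def)

text \<open>The tower is J^(n-j) g for j = 0, ..., n; it ends in g itself because J^0 is the
  identity.\<close>

lemma integral_derivs_test_function_frac_integral:
  fixes g :: "real \<Rightarrow> 'x::banach"
  assumes \<phi>: "test_function a b \<phi>" and ab: "a < b" and g: "continuous_on {a..b} g"
  shows "integral {a..b} (\<lambda>t. (deriv ^^ n) \<phi> t *\<^sub>R frac_integral a (real n) g t) =
    (-1) ^ n *\<^sub>R integral {a..b} (\<lambda>t. \<phi> t *\<^sub>R g t)"
proof -
  have "(frac_integral a (real (n - j)) g has_vector_derivative frac_integral a (real (n - Suc j)) g t) (at t within {a..b})"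
    if "j < n" "t \<in> {a..b}" for j t
  proof -
    have "real (n - j) = real (n - Suc j) + 1" using that by simp
    then show ?thesis using frac_integral_has_vector_derivative[OF ab g _ that(2), of "real (n - Suc j)"] by simp
  qed
  from integral_derivs_test_function[where F="\<lambda>j. frac_integral a (real (n - j)) g", OF \<phi> ab this]
  show ?thesis
    using g by (simp add: frac_integral_def[of a 0] cong: if_cong)
qed

lemma du_Bois_Reymond:
  fixes w :: "real \<Rightarrow> 'x::banach"
  assumes ab: "a < b" and "continuous_on {a..b} w"
    and "\<And>\<phi>. test_function a b \<phi> \<Longrightarrow> integral {a..b} (\<lambda>t. (deriv ^^ n) \<phi> t *\<^sub>R w t) = 0"
  shows "\<exists>c. \<forall>t\<in>{a..b}. w t = (\<Sum>k<n. (t - a) ^ k *\<^sub>R c k)"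
  using assms(2,3)
proof (induction n arbitrary: w)
  case 0
  have "w t = 0" if "t \<in> {a..b}" for t
    using 0(2) by (intro eq_0_if_integral_test_function[OF ab 0(1) _ that]) simp
  then show ?case by simp
next
  case (Suc n)
  note w = Suc.prems(1)
  \<comment> \<open>\<open>\<psi> - (\<integral>\<psi>) \<theta>\<close> is the derivative of a test function, so the order drops by one up to the
    monomial \<open>P\<close> whose \<open>n\<close>-th derivative is constant.\<close>
  obtain \<theta> where \<theta>: "test_function a b \<theta>" "integral {a..b} \<theta> = 1"
    by (rule test_function_bump[of a "(2 * a + b) / 3" "(a + 2 * b) / 3" b]) (use ab in auto)
  define C where "C = integral {a..b} (\<lambda>t. (deriv ^^ n) \<theta> t *\<^sub>R w t)"
  \<comment> \<open>P is (t - a)^n / n! times (-1)^n C. The sign cancels the one produced by n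
    integrations by parts, so that testing P against the n-th derivative of \<psi> gives the
    integral of \<psi> times C.\<close>
  define P where "P = frac_integral a (real n) (\<lambda>t. (-1) ^ n *\<^sub>R C)"
  have P: "continuous_on {a..b} P"
    unfolding P_def by (intro continuous_on_frac_integral ab continuous_intros) auto
  have dc: "continuous_on {a..b} ((deriv ^^ n) \<psi>)" if "test_function a b \<psi>" for \<psi>
    by (rule test_function_continuous[OF test_function_derivs[OF that ab]])
  have "\<exists>c. \<forall>t\<in>{a..b}. w t - P t = (\<Sum>k<n. (t - a) ^ k *\<^sub>R c k)"
  proof (rule Suc.IH)
    show "continuous_on {a..b} (\<lambda>t. w t - P t)" by (intro continuous_intros w P)
    fix \<psi> assume \<psi>: "test_function a b \<psi>"
    define r where "r = integral {a..b} \<psi>"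
    have \<eta>: "test_function a b (\<lambda>t. \<psi> t + (- r) * \<theta> t)"
      by (rule test_function_linear[OF \<psi> \<theta>(1) ab])
    have "((\<lambda>t. \<psi> t + (- r) * \<theta> t) has_integral r + (- r) * 1) {a..b}"
      unfolding r_def using \<theta>(2) test_function_continuous[OF \<psi>] test_function_continuous[OF \<theta>(1)]
      by (intro has_integral_add has_integral_mult_right) (metis integrable_continuous_real integrable_integral)+
    then have "integral {a..b} (\<lambda>t. \<psi> t + (- r) * \<theta> t) = 0" by (simp add: integral_unique)
    from test_function_antiderivative[OF \<eta> ab this] obtain \<phi> where
      \<phi>: "test_function a b \<phi>" "deriv \<phi> = (\<lambda>t. \<psi> t + (- r) * \<theta> t)" by blast
    have "(deriv ^^ Suc n) \<phi> = (\<lambda>t. (deriv ^^ n) \<psi> t + (- r) * (deriv ^^ n) \<theta> t)"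
      using deriv_funpow_linear[OF test_function_smooth[OF \<psi>] test_function_smooth[OF \<theta>(1)], of n "- r"]
      by (simp only: funpow_Suc_right o_apply \<phi>(2))
    with Suc.prems(2)[OF \<phi>(1)] have
      "integral {a..b} (\<lambda>t. ((deriv ^^ n) \<psi> t + (- r) * (deriv ^^ n) \<theta> t) *\<^sub>R w t) = 0" by (simp only:)
    moreover have "((\<lambda>t. ((deriv ^^ n) \<psi> t + (- r) * (deriv ^^ n) \<theta> t) *\<^sub>R w t) has_integral
        integral {a..b} (\<lambda>t. (deriv ^^ n) \<psi> t *\<^sub>R w t) + (- r) *\<^sub>R C) {a..b}"
      unfolding C_def scaleR_add_left scaleR_scaleR[symmetric]
      by (intro has_integral_add has_integral_cmul integrable_integral integrable_continuous_real
          continuous_intros w dc \<psi> \<theta>)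
    ultimately have 1: "integral {a..b} (\<lambda>t. (deriv ^^ n) \<psi> t *\<^sub>R w t) = r *\<^sub>R C"
      by (simp add: integral_unique)
    have "integral {a..b} (\<lambda>t. (deriv ^^ n) \<psi> t *\<^sub>R P t) = (-1) ^ n *\<^sub>R integral {a..b} (\<lambda>t. \<psi> t *\<^sub>R (-1) ^ n *\<^sub>R C)"
      unfolding P_def by (intro integral_derivs_test_function_frac_integral \<psi> ab continuous_intros)
    also have "integral {a..b} (\<lambda>t. \<psi> t *\<^sub>R (-1) ^ n *\<^sub>R C) = r *\<^sub>R (-1) ^ n *\<^sub>R C"
      unfolding r_def
      by (intro integral_unique has_integral_scaleR_left integrable_integral integrable_continuous_real test_function_continuous[OF \<psi>])
    finally have 2: "integral {a..b} (\<lambda>t. (deriv ^^ n) \<psi> t *\<^sub>R P t) = r *\<^sub>R C"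
      by (simp add: power_add[symmetric] mult.left_commute power_mult_distrib[symmetric])
    show "integral {a..b} (\<lambda>t. (deriv ^^ n) \<psi> t *\<^sub>R (w t - P t)) = 0"
      unfolding scaleR_diff_right
      by (subst Henstock_Kurzweil_Integration.integral_diff)
        (auto intro!: integrable_continuous_real continuous_intros w P dc \<psi> simp: 1 2)
  qed
  then obtain c where c: "\<forall>t\<in>{a..b}. w t - P t = (\<Sum>k<n. (t - a) ^ k *\<^sub>R c k)" by blast
  show ?case
  proof (intro exI ballI)
    fix t assume t: "t \<in> {a..b}"
    have "P t = (t - a) ^ n *\<^sub>R ((1 / fact n) *\<^sub>R (-1) ^ n *\<^sub>R C)"
      using t by (simp add: P_def frac_integral_nat_const)
    then show "w t = (\<Sum>k<Suc n. (t - a) ^ k *\<^sub>R (c(n := (1 / fact n) *\<^sub>R (-1) ^ n *\<^sub>R C)) k)"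
      using c[rule_format, OF t] by (simp add: algebra_simps)
  qed
qed

text \<open>Reduces weak derivatives to Henstock-Kurzweil integrals over the closed interval.
  \<open>u'\<close> is kept apart from the continuous \<open>u\<close> because
  \<open>RL_integral\<close> is later identified with \<open>frac_integral\<close> pointwise, not as
  a function on the whole line.\<close>

lemma has_weak_derivative_iff:
  fixes u u' g :: "real \<Rightarrow> 'x::banach"
  assumes ab: "a < b" and u: "continuous_on {a..b} u" and g: "continuous_on {a..b} g"
    and eq: "\<And>t. t \<in> {a<..<b} \<Longrightarrow> u' t = u t"
  shows "has_weak_derivative a b n u' g \<longleftrightarrow>
    (\<forall>\<phi>. test_function a b \<phi> \<longrightarrow>
      integral {a..b} (\<lambda>t. (deriv ^^ n) \<phi> t *\<^sub>R u t) = (-1) ^ n *\<^sub>R integral {a..b} (\<lambda>t. \<phi> t *\<^sub>R g t))"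
proof -
  have loc: "locally_Bochner_integrable {a<..<b} h"
    if "continuous_on {a..b} f" "\<And>t. t \<in> {a<..<b} \<Longrightarrow> h t = f t" for f h :: "real \<Rightarrow> 'x"
    unfolding locally_Bochner_integrable_def
  proof (intro allI impI, elim conjE)
    fix K :: "real set" assume K: "compact K" "K \<subseteq> {a<..<b}"
    have Km: "K \<in> lmeasurable" using K(1) by (rule lmeasurable_compact)
    have "(\<lambda>_. 1 :: real) integrable_on K" using Km by (simp add: lmeasurable_iff_integrable_on)
    then have "(\<lambda>_. 1 :: real) absolutely_integrable_on K" by (rule nonnegative_absolutely_integrable_1) simp
    then have "integrable (lebesgue_on K) (\<lambda>_. 1 :: real)"
      using Km by (intro absolutely_integrable_imp_integrable) auto
    then show "Bochner_integrable (lebesgue_on K) h"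
      using K Km that by (intro Bochner_integrable_scaleR_continuous[where a=a and b=b and k="\<lambda>_. 1" and f=f]) auto
  qed
  have eqI: "Bochner (lebesgue_on {a<..<b}) (\<lambda>t. \<psi> t *\<^sub>R h t) = integral {a..b} (\<lambda>t. \<psi> t *\<^sub>R f t)"
    if \<psi>: "test_function a b \<psi>" and f: "continuous_on {a..b} f" and h: "\<And>t. t \<in> {a<..<b} \<Longrightarrow> h t = f t"
    for f h :: "real \<Rightarrow> 'x" and \<psi>
  proof -
    have "\<psi> absolutely_integrable_on {a..b}"
      by (intro absolutely_integrable_continuous_real test_function_continuous[OF \<psi>])
    then have "\<psi> absolutely_integrable_on {a<..<b}"
      by (rule set_integrable_subset) auto
    then have int: "integrable (lebesgue_on {a<..<b}) \<psi>"
      by (rule absolutely_integrable_imp_integrable) simp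
    have B: "Bochner_integrable (lebesgue_on {a<..<b}) (\<lambda>t. \<psi> t *\<^sub>R h t)"
      by (rule Bochner_integrable_scaleR_continuous[OF _ _ int f]) (auto simp: h)
    have "Bochner (lebesgue_on {a<..<b}) (\<lambda>t. \<psi> t *\<^sub>R h t) = integral {a<..<b} (\<lambda>t. \<psi> t *\<^sub>R h t)"
      by (rule Bochner_eq_integral(2)[OF _ _ B, of a b]) auto
    also have "\<dots> = integral {a<..<b} (\<lambda>t. \<psi> t *\<^sub>R f t)"
      by (rule integral_cong) (simp add: h)
    also have "\<dots> = integral {a..b} (\<lambda>t. \<psi> t *\<^sub>R f t)"
      using integral_open_interval[of a b "\<lambda>t. \<psi> t *\<^sub>R f t"] by simp
    finally show ?thesis .
  qed
  show ?thesis
    unfolding has_weak_derivative_def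
    using loc[OF u eq] loc[OF g] eqI[OF test_function_derivs[OF _ ab] u eq] eqI[OF _ g] by simp
qed

section \<open>Riemann--Liouville spaces\<close>

text \<open>Injectivity of J^\<gamma>. Applying J^(n-\<gamma>) raises the order to a natural number
  n, and n ordinary differentiations then recover w.\<close>

lemma frac_integral_eq_0_imp:
  fixes w :: "real \<Rightarrow> 'x::banach"
  assumes ab: "a < b" and w: "continuous_on {a..b} w" and \<gamma>: "\<gamma> \<ge> 0"
    and 0: "\<And>t. t \<in> {a..b} \<Longrightarrow> frac_integral a \<gamma> w t = 0" and t: "t \<in> {a..b}"
  shows "w t = 0"
proof -
  have nat: "\<forall>t\<in>{a..b}. w t = 0" if "\<forall>t\<in>{a..b}. frac_integral a (real n) w t = 0" for n
    using that
  proof (induction n)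
    case 0
    then show ?case by (simp add: frac_integral_def)
  next
    case (Suc n)
    have "frac_integral a (real n) w t = 0" if t: "t \<in> {a..b}" for t
    proof -
      have "(frac_integral a (real n + 1) w has_vector_derivative frac_integral a (real n) w t) (at t within {a..b})"
        by (intro frac_integral_has_vector_derivative ab w t) simp
      moreover have "frac_integral a (real n + 1) w s = 0" if "s \<in> {a..b}" for s
        using bspec[OF Suc.prems that] by (simp add: add.commute)
      then have "(frac_integral a (real n + 1) w has_vector_derivative 0) (at t within {a..b})"
        using has_vector_derivative_transform[OF t _ has_vector_derivative_const] by blast
      ultimately show ?thesis
        by (rule vector_derivative_unique_within_closed_interval[unfolded box_real, OF ab t])
    qed
    then show ?case by (intro Suc.IH ballI)
  qed
  define n where "n = nat \<lceil>\<gamma>\<rceil>"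
  have n: "\<gamma> \<le> real n" by (simp add: n_def real_nat_ceiling_ge)
  have "frac_integral a (real n) w t = 0" if t: "t \<in> {a..b}" for t
  proof -
    have "frac_integral a (real n) w t = frac_integral a (real n - \<gamma>) (frac_integral a \<gamma> w) t"
      using n \<gamma> frac_integral_semigroup[OF ab w, of "real n - \<gamma>" \<gamma> t] t by simp
    also have "\<dots> = frac_integral a (real n - \<gamma>) (\<lambda>_. 0) t"
      using t by (intro frac_integral_cong) (auto simp: 0)
    finally show ?thesis by simp
  qed
  then show ?thesis using nat t by blast
qed

lemma frac_integral_const_eq_imp_0:
  fixes g :: "real \<Rightarrow> 'x::banach"
  assumes ab: "a < b" and g: "continuous_on {a..b} g" and "0 \<le> \<gamma>" "\<gamma> < \<delta>"
    and eq: "\<And>t. t \<in> {a..b} \<Longrightarrow> frac_integral a \<gamma> (\<lambda>_. x) t = frac_integral a \<delta> g t"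
  shows "x = 0"
proof -
  let ?h = "frac_integral a (\<delta> - \<gamma>) g"
  have h: "continuous_on {a..b} ?h" using assms by (intro continuous_on_frac_integral) auto
  have "frac_integral a \<gamma> (\<lambda>t. x - ?h t) t = 0" if t: "t \<in> {a..b}" for t
  proof -
    have "frac_integral a \<gamma> (\<lambda>t. x - ?h t) t = frac_integral a \<gamma> (\<lambda>_. x) t - frac_integral a \<gamma> ?h t"
      using assms t h by (intro frac_integral_diff[where b=b] continuous_intros) auto
    also have "frac_integral a \<gamma> ?h t = frac_integral a \<delta> g t"
      using frac_integral_semigroup[OF ab g, of \<gamma> "\<delta> - \<gamma>" t] assms t by simp
    finally show ?thesis by (simp add: eq[OF t])
  qed
  moreover have "continuous_on {a..b} (\<lambda>t. x - ?h t)" by (intro continuous_intros h)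
  ultimately have "x - ?h a = 0"
    using frac_integral_eq_0_imp[OF ab _ \<open>0 \<le> \<gamma>\<close>, of "\<lambda>t. x - ?h t" a] ab by simp
  then show ?thesis using assms by (simp add: frac_integral_left)
qed

section \<open>Continuously differentiable functions on the compact interval\<close>

lemma higher_deriv_on_eq:
  fixes F :: "nat \<Rightarrow> real \<Rightarrow> 'x::real_normed_vector"
  assumes ab: "a < b"
    and F: "\<And>j t. j < k \<Longrightarrow> t \<in> {a..b} \<Longrightarrow> (F j has_vector_derivative F (Suc j) t) (at t within {a..b})"
    and f: "\<And>t. t \<in> {a..b} \<Longrightarrow> f t = F 0 t"
    and "j \<le> k" "t \<in> {a..b}"
  shows "higher_deriv_on {a..b} j f t = F j t"
  using assms(4,5)
proof (induction j arbitrary: t)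
  case (Suc j)
  have "(higher_deriv_on {a..b} j f has_vector_derivative F (Suc j) t) (at t within {a..b})"
    using Suc by (intro has_vector_derivative_transform[OF _ _ F]) auto
  \<comment> \<open>Derivatives within {a..b} are unique even at the end points because a < b, so
    \<open>vector_derivative\<close> returns the given member of the tower.\<close>
  then show ?case
    using vector_derivative_within_cbox[unfolded box_real, OF ab Suc.prems(2)] by simp
qed (simp add: f)

lemma C_spaceI:
  fixes F :: "nat \<Rightarrow> real \<Rightarrow> 'x::real_normed_vector"
  assumes ab: "a < b"
    and F: "\<And>j t. j < k \<Longrightarrow> t \<in> {a..b} \<Longrightarrow> (F j has_vector_derivative F (Suc j) t) (at t within {a..b})"
    and f: "\<And>t. t \<in> {a..b} \<Longrightarrow> f t = F 0 t"
    and cont: "continuous_on {a..b} (F k)"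
  shows "f \<in> C_space a b k"
proof -
  have eq: "higher_deriv_on {a..b} j f t = F j t" if "j \<le> k" "t \<in> {a..b}" for j t
    using higher_deriv_on_eq[OF ab F f that] .
  have "higher_deriv_on {a..b} j f differentiable (at t within {a..b})" if "j < k" "t \<in> {a..b}" for j t
  proof -
    have "(higher_deriv_on {a..b} j f has_vector_derivative F (Suc j) t) (at t within {a..b})"
      using that by (intro has_vector_derivative_transform[OF _ _ F]) (auto intro: eq)
    then show ?thesis by (rule differentiableI_vector)
  qed
  moreover have "continuous_on {a..b} (higher_deriv_on {a..b} k f)"
    using cont by (rule continuous_on_eq) (auto simp: eq)
  ultimately show ?thesis by (simp add: C_space_def)
qed

lemma C_space_has_vector_derivative:
  assumes "f \<in> C_space a b k" "j < k" "t \<in> {a..b}"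
  shows "(higher_deriv_on {a..b} j f has_vector_derivative higher_deriv_on {a..b} (Suc j) f t) (at t within {a..b})"
  using assms by (simp add: C_space_def vector_derivative_works[symmetric])

lemma C_space_continuous:
  assumes "f \<in> C_space a b k" "j \<le> k"
  shows "continuous_on {a..b} (higher_deriv_on {a..b} j f)"
proof (cases "j = k")
  case False
  then show ?thesis
    using C_space_has_vector_derivative[OF assms(1), of j] assms(2) has_vector_derivative_continuous
    unfolding continuous_on_eq_continuous_within by (metis le_neq_implies_less)
qed (use assms in \<open>simp add: C_space_def\<close>)

lemma C_space_continuous_0: "f \<in> C_space a b k \<Longrightarrow> continuous_on {a..b} f"
  using C_space_continuous[of f a b k 0] by simp

lemma C_space_antimono: "f \<in> C_space a b k \<Longrightarrow> j \<le> k \<Longrightarrow> f \<in> C_space a b j"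
  using C_space_continuous[of f a b k j] by (auto simp: C_space_def)

lemma norm_le_SUP:
  fixes h :: "real \<Rightarrow> 'x::real_normed_vector"
  assumes "continuous_on {a..b} h" "t \<in> {a..b}"
  shows "norm (h t) \<le> (SUP t\<in>{a..b}. norm (h t))"
proof -
  have "compact ((\<lambda>t. norm (h t)) ` {a..b})"
    by (intro compact_continuous_image continuous_intros assms compact_Icc)
  then have "bdd_above ((\<lambda>t. norm (h t)) ` {a..b})"
    by (intro bounded_imp_bdd_above compact_imp_bounded)
  then show ?thesis using assms(2) by (rule cSUP_upper[rotated])
qed

lemma SUP_norm_nonneg:
  fixes h :: "real \<Rightarrow> 'x::real_normed_vector"
  assumes "a \<le> b" "continuous_on {a..b} h"
  shows "0 \<le> (SUP t\<in>{a..b}. norm (h t))"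
  using norm_le_SUP[OF assms(2), of a] assms(1) norm_ge_zero[of "h a"] by (simp del: norm_ge_zero)

lemma C_norm_mono:
  assumes "a \<le> b" "f \<in> C_space a b k" "j \<le> k"
  shows "C_norm a b j f \<le> C_norm a b k f"
  unfolding C_norm_def
  using assms by (intro sum_mono2 SUP_norm_nonneg C_space_continuous[where k=k]) auto

section \<open>Continuous Riemann-Liouville derivatives and their uniqueness\<close>

lemma nat_ceiling_not_Nats:
  fixes \<beta> :: real
  assumes "\<beta> \<notin> \<nat>" "\<beta> \<ge> 0"
  shows "of_int \<lceil>\<beta>\<rceil> = real (nat \<lceil>\<beta>\<rceil>)" "real (nat \<lceil>\<beta>\<rceil>) < \<beta> + 1" "\<beta> < real (nat \<lceil>\<beta>\<rceil>)" "nat \<lceil>\<beta>\<rceil> \<ge> 1" "\<beta> > 0"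
proof -
  show p: "\<beta> > 0" using assms by (metis Nats_0 less_eq_real_def)
  show *: "of_int \<lceil>\<beta>\<rceil> = real (nat \<lceil>\<beta>\<rceil>)" using assms(2) by simp
  show "real (nat \<lceil>\<beta>\<rceil>) < \<beta> + 1" unfolding *[symmetric] by linarith
  have "\<beta> \<noteq> real (nat \<lceil>\<beta>\<rceil>)" using assms(1) by (metis of_nat_in_Nats)
  then show "\<beta> < real (nat \<lceil>\<beta>\<rceil>)" using real_nat_ceiling_ge[of \<beta>] by linarith
  then show "nat \<lceil>\<beta>\<rceil> \<ge> 1" using p by (cases "nat \<lceil>\<beta>\<rceil>") auto
qed

lemma is_continuous_RL_deriv_iff:
  fixes f g :: "real \<Rightarrow> 'x::banach"
  assumes ab: "a < b" and f: "continuous_on {a..b} f" and \<beta>: "\<beta> \<ge> 0" and n: "n = nat \<lceil>\<beta>\<rceil>"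
  shows "is_continuous_RL_deriv a b \<beta> f g \<longleftrightarrow> continuous_on {a..b} g \<and>
    (\<forall>\<phi>. test_function a b \<phi> \<longrightarrow>
      integral {a..b} (\<lambda>t. (deriv ^^ n) \<phi> t *\<^sub>R frac_integral a (real n - \<beta>) f t) =
      (-1) ^ n *\<^sub>R integral {a..b} (\<lambda>t. \<phi> t *\<^sub>R g t))"
proof -
  have n': "of_int \<lceil>\<beta>\<rceil> = real n" using \<beta> by (simp add: n)
  have d: "real n - \<beta> \<ge> 0" using real_nat_ceiling_ge[of \<beta>] by (simp add: n)
  have eq: "RL_integral a (real n - \<beta>) f t = frac_integral a (real n - \<beta>) f t" if "t \<in> {a<..<b}" for t
    using that by (intro RL_integral_eq_frac_integral[OF f _ d]) auto
  show ?thesis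
    unfolding is_continuous_RL_deriv_def n' n[symmetric]
    using has_weak_derivative_iff[OF ab continuous_on_frac_integral[OF ab f d] _ eq, of g n] by auto
qed

text \<open>Determines the \<open>SOME\<close> in \<open>RL_deriv\<close> on the interval, so that
  \<open>RL_norm\<close> can be computed from any witness. The difference of two witnesses is
  annihilated by all test functions.\<close>

lemma is_continuous_RL_deriv_unique:
  fixes f g h :: "real \<Rightarrow> 'x::banach"
  assumes ab: "a < b" and f: "continuous_on {a..b} f" and \<beta>: "\<beta> \<ge> 0"
    and g: "is_continuous_RL_deriv a b \<beta> f g" and h: "is_continuous_RL_deriv a b \<beta> f h" and t: "t \<in> {a..b}"
  shows "g t = h t"
proof -
  note iff = is_continuous_RL_deriv_iff[OF ab f \<beta> refl]
  have c: "continuous_on {a..b} g" "continuous_on {a..b} h" using g h iff by auto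
  have "integral {a..b} (\<lambda>t. \<phi> t *\<^sub>R (g t - h t)) = 0" if \<phi>: "test_function a b \<phi>" for \<phi>
  proof -
    have "(-1) ^ nat \<lceil>\<beta>\<rceil> *\<^sub>R integral {a..b} (\<lambda>t. \<phi> t *\<^sub>R g t) =
        (-1) ^ nat \<lceil>\<beta>\<rceil> *\<^sub>R integral {a..b} (\<lambda>t. \<phi> t *\<^sub>R h t)"
      using g h \<phi> unfolding iff by simp
    then have "integral {a..b} (\<lambda>t. \<phi> t *\<^sub>R g t) = integral {a..b} (\<lambda>t. \<phi> t *\<^sub>R h t)"
      by (subst (asm) scaleR_cancel_left) simp
    then show ?thesis
      unfolding scaleR_diff_right
      by (subst Henstock_Kurzweil_Integration.integral_diff)
        (auto intro!: integrable_continuous_real continuous_intros c test_function_continuous[OF \<phi>])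
  qed
  moreover have "continuous_on {a..b} (\<lambda>t. g t - h t)" by (intro continuous_intros c)
  ultimately have "g t - h t = 0" using ab t by (intro eq_0_if_integral_test_function[of a b "\<lambda>t. g t - h t"])
  then show ?thesis by simp
qed

lemma RL_deriv_eq:
  fixes f g :: "real \<Rightarrow> 'x::banach"
  assumes "a < b" "continuous_on {a..b} f" "\<beta> \<ge> 0" "is_continuous_RL_deriv a b \<beta> f g"
  shows "is_continuous_RL_deriv a b \<beta> f (RL_deriv a b \<beta> f)"
    and "t \<in> {a..b} \<Longrightarrow> RL_deriv a b \<beta> f t = g t"
proof -
  show *: "is_continuous_RL_deriv a b \<beta> f (RL_deriv a b \<beta> f)"
    unfolding RL_deriv_def using assms(4) by (rule someI[of "is_continuous_RL_deriv a b \<beta> f"])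
  show "t \<in> {a..b} \<Longrightarrow> RL_deriv a b \<beta> f t = g t"
    using is_continuous_RL_deriv_unique[OF assms(1-3) * assms(4)] .
qed

section \<open>Non-natural orders: representation by fractional integrals\<close>

lemma powr_has_vector_derivative:
  assumes "a < t"
  shows "((\<lambda>t. (t - a) powr r) has_vector_derivative r * (t - a) powr (r - 1)) (at t within S)"
  unfolding has_real_derivative_iff_has_vector_derivative[symmetric]
  using assms by (auto intro!: derivative_eq_intros)

lemma eq_on_closed_interval:
  fixes f g :: "real \<Rightarrow> 'x::real_normed_vector"
  assumes "a < b" "continuous_on {a..b} f" "continuous_on {a..b} g"
    and "\<And>t. t \<in> {a<..<b} \<Longrightarrow> f t = g t" and "t \<in> {a..b}"
  shows "f t = g t"
proof -
  have "continuous_on (closure {a<..<b}) (\<lambda>t. f t - g t)"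
    using assms(1-3) by (auto intro!: continuous_intros)
  from continuous_constant_on_closure[OF this, of 0 t] show ?thesis using assms by auto
qed

text \<open>
  Induction on \<open>m\<close>: multiplying \<open>G 1\<close> by \<open>(t - a) powr \<gamma>\<close> and letting \<open>t\<close> tend to \<open>a\<close> isolates \<open>v 1\<close>.
\<close>

lemma powr_sum_coeffs_eq_0:
  fixes G :: "nat \<Rightarrow> real \<Rightarrow> 'x::real_normed_vector"
  assumes ab: "a < b" and \<gamma>: "0 < \<gamma>" "\<gamma> < 1"
    and "\<And>j t. j < m \<Longrightarrow> t \<in> {a..b} \<Longrightarrow> (G j has_vector_derivative G (Suc j) t) (at t within {a..b})"
    and "continuous_on {a..b} (G m)"
    and "\<And>t. t \<in> {a..b} \<Longrightarrow> G 0 t = (\<Sum>k=1..m. (t - a) powr (real k - \<gamma>) *\<^sub>R v k)"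
  shows "\<forall>k\<in>{1..m}. v k = 0"
  using assms(4-6)
proof (induction m arbitrary: G v)
  case (Suc m)
  note G = Suc.prems(1)
  have G1: "continuous_on {a..b} (G 1)"
  proof (cases "m = 0")
    case False
    then show ?thesis
      using G[of 1] has_vector_derivative_continuous unfolding continuous_on_eq_continuous_within
      by (metis One_nat_def Suc_mono neq0_conv)
  qed (use Suc.prems(2) in simp)
  have deriv: "G 1 t = (\<Sum>k=1..Suc m. ((real k - \<gamma>) * (t - a) powr (real k - \<gamma> - 1)) *\<^sub>R v k)"
    if t: "t \<in> {a<..<b}" for t
  proof -
    have t': "t \<in> {a..b}" "a < t" using t by auto
    have "((\<lambda>t. \<Sum>k=1..Suc m. (t - a) powr (real k - \<gamma>) *\<^sub>R v k) has_vector_derivative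
        (\<Sum>k=1..Suc m. ((real k - \<gamma>) * (t - a) powr (real k - \<gamma> - 1)) *\<^sub>R v k)) (at t within {a..b})"
      by (intro has_vector_derivative_sum bounded_linear.has_vector_derivative[OF bounded_linear_scaleR_left]
          powr_has_vector_derivative t')
    then have "(G 0 has_vector_derivative
        (\<Sum>k=1..Suc m. ((real k - \<gamma>) * (t - a) powr (real k - \<gamma> - 1)) *\<^sub>R v k)) (at t within {a..b})"
      by (rule has_vector_derivative_transform[OF t'(1), rotated]) (rule Suc.prems(3))
    moreover have "(G 0 has_vector_derivative G 1 t) (at t within {a..b})"
      using G[of 0 t] t' by simp
    ultimately show ?thesis
      by (rule vector_derivative_unique_within_closed_interval[unfolded box_real, OF ab t'(1), rotated])
  qed
  \<comment> \<open>After multiplication by (t - a)^\<gamma> the exponents k - \<gamma> - 1 become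
    the natural numbers k - 1, and both sides extend continuously to a. There the left side is 0,
    while \<open>0 ^ 0 = 1\<close> leaves (1 - \<gamma>) v 1 on the right.\<close>
  have "(a - a) powr \<gamma> *\<^sub>R G 1 a = (\<Sum>k=1..Suc m. ((real k - \<gamma>) * (a - a) ^ (k - 1)) *\<^sub>R v k)"
  proof (rule eq_on_closed_interval[OF ab, where t=a and f="\<lambda>t. (t - a) powr \<gamma> *\<^sub>R G 1 t"
        and g="\<lambda>t. \<Sum>k=1..Suc m. ((real k - \<gamma>) * (t - a) ^ (k - 1)) *\<^sub>R v k"])
    show "continuous_on {a..b} (\<lambda>t. (t - a) powr \<gamma> *\<^sub>R G 1 t)"
      by (intro continuous_intros continuous_on_powr_diff G1 \<gamma>)
    show "continuous_on {a..b} (\<lambda>t. \<Sum>k=1..Suc m. ((real k - \<gamma>) * (t - a) ^ (k - 1)) *\<^sub>R v k)"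
      by (intro continuous_intros)
    fix t assume t: "t \<in> {a<..<b}"
    have "(t - a) powr \<gamma> * (t - a) powr (real k - \<gamma> - 1) = (t - a) ^ (k - 1)" if "k \<in> {1..Suc m}" for k
      using that t by (simp add: powr_add[symmetric] powr_realpow[symmetric] of_nat_diff)
    then show "(t - a) powr \<gamma> *\<^sub>R G 1 t = (\<Sum>k=1..Suc m. ((real k - \<gamma>) * (t - a) ^ (k - 1)) *\<^sub>R v k)"
      unfolding deriv[OF t] scaleR_sum_right scaleR_scaleR
      by (intro sum.cong refl) (simp add: mult.left_commute)
  qed (use ab in auto)
  also have "\<dots> = (\<Sum>k\<in>{1}. ((real k - \<gamma>) * (a - a) ^ (k - 1)) *\<^sub>R v k)"
    by (intro sum.mono_neutral_right) auto
  finally have v1: "v 1 = 0" using \<gamma> by simp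
  \<comment> \<open>With v 1 gone, the derivative has exponents k - \<gamma> again after the shift k
    to k + 1. The induction hypothesis applies to the tower started at G 1 with the rescaled
    coefficients.\<close>
  have "\<forall>k\<in>{1..m}. (real (Suc k) - \<gamma>) *\<^sub>R v (Suc k) = 0"
  proof (rule Suc.IH[of "\<lambda>j. G (Suc j)"])
    show "(G (Suc j) has_vector_derivative G (Suc (Suc j)) t) (at t within {a..b})" if "j < m" "t \<in> {a..b}" for j t
      using G that by simp
    show "continuous_on {a..b} (G (Suc m))" by fact
    fix t assume "t \<in> {a..b}"
    then show "G (Suc 0) t = (\<Sum>k=1..m. (t - a) powr (real k - \<gamma>) *\<^sub>R (real (Suc k) - \<gamma>) *\<^sub>R v (Suc k))"
    proof (rule eq_on_closed_interval[OF ab, where f="G (Suc 0)"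
          and g="\<lambda>t. \<Sum>k=1..m. (t - a) powr (real k - \<gamma>) *\<^sub>R (real (Suc k) - \<gamma>) *\<^sub>R v (Suc k)", rotated -1])
      show "continuous_on {a..b} (\<lambda>t. \<Sum>k=1..m. (t - a) powr (real k - \<gamma>) *\<^sub>R (real (Suc k) - \<gamma>) *\<^sub>R v (Suc k))"
        using \<gamma> by (intro continuous_intros continuous_on_powr_diff) auto
      fix t assume t: "t \<in> {a<..<b}"
      have "G 1 t = (\<Sum>k=Suc 1..Suc m. ((real k - \<gamma>) * (t - a) powr (real k - \<gamma> - 1)) *\<^sub>R v k)"
        unfolding deriv[OF t] using v1 by (subst sum.atLeast_Suc_atMost) auto
      also have "\<dots> = (\<Sum>k=1..m. ((real (Suc k) - \<gamma>) * (t - a) powr (real (Suc k) - \<gamma> - 1)) *\<^sub>R v (Suc k))"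
        by (rule sum.shift_bounds_cl_Suc_ivl)
      finally show "G (Suc 0) t = (\<Sum>k=1..m. (t - a) powr (real k - \<gamma>) *\<^sub>R (real (Suc k) - \<gamma>) *\<^sub>R v (Suc k))"
        by (simp add: mult.commute)
    qed (use G1 in auto)
  qed
  then have v: "v (Suc k) = 0" if "k \<in> {1..m}" for k
    using that \<gamma> by force
  show ?case
  proof
    fix k assume "k \<in> {1..Suc m}"
    then consider "k = 1" | j where "k = Suc j" "j \<in> {1..m}" by (cases k) force+
    then show "v k = 0" using v1 v by cases auto
  qed
qed simp

text \<open>By the semigroup law J^(n-\<beta>) f = J^n g, and g is the n-th weak derivative of the
  latter.\<close>

lemma is_continuous_RL_deriv_frac_integral:
  fixes f g :: "real \<Rightarrow> 'x::banach"
  assumes ab: "a < b" and \<beta>: "\<beta> \<ge> 0" and g: "continuous_on {a..b} g"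
    and f: "\<And>t. t \<in> {a..b} \<Longrightarrow> f t = frac_integral a \<beta> g t"
  shows "is_continuous_RL_deriv a b \<beta> f g"
proof -
  define n where "n = nat \<lceil>\<beta>\<rceil>"
  have n: "real n - \<beta> \<ge> 0" using real_nat_ceiling_ge[of \<beta>] by (simp add: n_def)
  have fc: "continuous_on {a..b} f"
    using continuous_on_frac_integral[OF ab g \<beta>] by (rule continuous_on_eq) (simp add: f)
  have eq: "frac_integral a (real n - \<beta>) f t = frac_integral a (real n) g t" if t: "t \<in> {a..b}" for t
  proof -
    have "frac_integral a (real n - \<beta>) f t = frac_integral a (real n - \<beta>) (frac_integral a \<beta> g) t"
      using t by (intro frac_integral_cong f) auto
    then show ?thesis using frac_integral_semigroup[OF ab g n \<beta> t] by simp
  qed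
  have "integral {a..b} (\<lambda>t. (deriv ^^ n) \<phi> t *\<^sub>R frac_integral a (real n - \<beta>) f t) =
      (-1) ^ n *\<^sub>R integral {a..b} (\<lambda>t. \<phi> t *\<^sub>R g t)" if \<phi>: "test_function a b \<phi>" for \<phi>
  proof -
    have "integral {a..b} (\<lambda>t. (deriv ^^ n) \<phi> t *\<^sub>R frac_integral a (real n - \<beta>) f t) =
        integral {a..b} (\<lambda>t. (deriv ^^ n) \<phi> t *\<^sub>R frac_integral a (real n) g t)"
      by (rule integral_cong) (simp add: eq)
    then show ?thesis using integral_derivs_test_function_frac_integral[OF \<phi> ab g, of n] by simp
  qed
  then show ?thesis
    unfolding is_continuous_RL_deriv_iff[OF ab fc \<beta> n_def] using g by blast
qed

text \<open>Each derivative lowers the order of the fractional integral by one; the last order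
  \<beta> - k is still nonnegative.\<close>

lemma frac_integral_C_space:
  fixes f g :: "real \<Rightarrow> 'x::banach"
  assumes ab: "a < b" and k: "real k \<le> \<beta>" and g: "continuous_on {a..b} g"
    and f: "\<And>t. t \<in> {a..b} \<Longrightarrow> f t = frac_integral a \<beta> g t"
  shows "f \<in> C_space a b k"
    and "j \<le> k \<Longrightarrow> t \<in> {a..b} \<Longrightarrow> higher_deriv_on {a..b} j f t = frac_integral a (\<beta> - real j) g t"
proof -
  have F: "(frac_integral a (\<beta> - real j) g has_vector_derivative frac_integral a (\<beta> - real (Suc j)) g t) (at t within {a..b})"
    if "j < k" "t \<in> {a..b}" for j t
    using frac_integral_has_vector_derivative[OF ab g _ that(2), of "\<beta> - real (Suc j)"] that(1) k by simp
  have f0: "f t = frac_integral a (\<beta> - real 0) g t" if "t \<in> {a..b}" for t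
    using f[OF that] by simp
  show "f \<in> C_space a b k"
    using F f0 continuous_on_frac_integral[OF ab g, of "\<beta> - real k"] k
    by (intro C_spaceI[OF ab, where F="\<lambda>j. frac_integral a (\<beta> - real j) g"]) auto
  show "higher_deriv_on {a..b} j f t = frac_integral a (\<beta> - real j) g t" if "j \<le> k" "t \<in> {a..b}"
    using F f0 that by (intro higher_deriv_on_eq[OF ab, where F="\<lambda>j. frac_integral a (\<beta> - real j) g"]) auto
qed

lemma eq_frac_integral_RL_deriv:
  fixes f g :: "real \<Rightarrow> 'x::banach"
  assumes ab: "a < b" and \<beta>: "\<beta> \<notin> \<nat>" "\<beta> \<ge> 0" and f: "f \<in> C_space a b (nat \<lceil>\<beta>\<rceil> - 1)"
    and g: "is_continuous_RL_deriv a b \<beta> f g" and t: "t \<in> {a..b}"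
  shows "f t = frac_integral a \<beta> g t"
proof -
  define n where "n = nat \<lceil>\<beta>\<rceil>"
  define \<gamma> where "\<gamma> = real n - \<beta>"
  have n: "real n < \<beta> + 1" "\<beta> < real n" "n \<ge> 1" "\<beta> > 0"
    using nat_ceiling_not_Nats[OF \<beta>] by (auto simp: n_def)
  then have \<gamma>: "0 < \<gamma>" "\<gamma> < 1" by (auto simp: \<gamma>_def)
  have fc: "continuous_on {a..b} f" using f by (rule C_space_continuous_0)
  have gc: "continuous_on {a..b} g"
    and weak: "\<And>\<phi>. test_function a b \<phi> \<Longrightarrow> integral {a..b} (\<lambda>t. (deriv ^^ n) \<phi> t *\<^sub>R frac_integral a \<gamma> f t) =
      (-1) ^ n *\<^sub>R integral {a..b} (\<lambda>t. \<phi> t *\<^sub>R g t)"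
    using g unfolding is_continuous_RL_deriv_iff[OF ab fc \<beta>(2) n_def] \<gamma>_def by auto
  note cJ = continuous_on_frac_integral[OF ab]
  have "\<exists>c. \<forall>t\<in>{a..b}. frac_integral a \<gamma> f t - frac_integral a (real n) g t = (\<Sum>k<n. (t - a) ^ k *\<^sub>R c k)"
  proof (rule du_Bois_Reymond[OF ab])
    show c: "continuous_on {a..b} (\<lambda>t. frac_integral a \<gamma> f t - frac_integral a (real n) g t)"
      using \<gamma> by (intro continuous_intros cJ fc gc) auto
    fix \<phi> assume \<phi>: "test_function a b \<phi>"
    have "integral {a..b} (\<lambda>t. (deriv ^^ n) \<phi> t *\<^sub>R (frac_integral a \<gamma> f t - frac_integral a (real n) g t)) =
        integral {a..b} (\<lambda>t. (deriv ^^ n) \<phi> t *\<^sub>R frac_integral a \<gamma> f t) -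
        integral {a..b} (\<lambda>t. (deriv ^^ n) \<phi> t *\<^sub>R frac_integral a (real n) g t)"
      unfolding scaleR_diff_right using \<gamma>
      by (intro Henstock_Kurzweil_Integration.integral_diff integrable_continuous_real continuous_intros cJ fc gc
          test_function_continuous[OF test_function_derivs[OF \<phi> ab]]) auto
    then show "integral {a..b} (\<lambda>t. (deriv ^^ n) \<phi> t *\<^sub>R (frac_integral a \<gamma> f t - frac_integral a (real n) g t)) = 0"
      using weak[OF \<phi>] integral_derivs_test_function_frac_integral[OF \<phi> ab gc, of n] by simp
  qed
  then obtain c where c: "\<And>t. t \<in> {a..b} \<Longrightarrow>
      frac_integral a \<gamma> f t - frac_integral a (real n) g t = (\<Sum>k<n. (t - a) ^ k *\<^sub>R c k)" by blast
  \<comment> \<open>Evaluation at t = a: both fractional integrals have positive order and vanish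
    there, and \<open>0 ^ 0 = 1\<close> isolates \<open>c 0\<close>.\<close>
  have "0 = (\<Sum>k<n. (a - a) ^ k *\<^sub>R c k)"
    using c[of a] ab \<gamma> n by (simp add: frac_integral_left)
  also have "\<dots> = (\<Sum>k\<in>{0}. (a - a) ^ k *\<^sub>R c k)"
    using n by (intro sum.mono_neutral_right) auto
  finally have c0: "c 0 = 0" by simp
  have c': "frac_integral a \<gamma> f t - frac_integral a (real n) g t = (\<Sum>k=1..n-1. (t - a) ^ k *\<^sub>R c k)"
    if "t \<in> {a..b}" for t
  proof -
    have "k = 0" if "k \<in> {..<n} - {1..n-1}" for k using that by (cases k) auto
    then show ?thesis
      unfolding c[OF that] using c0 n by (intro sum.mono_neutral_right) force+
  qed
  \<comment> \<open>J^\<gamma> maps (t - a)^(k-\<gamma>) to Gamma(k - \<gamma> + 1) / Gamma(k + 1)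
    times (t - a)^k. The coefficients \<open>v k\<close> invert this factor, so that J^\<gamma> h is
    the polynomial remainder.\<close>
  define v where "v k = (Gamma (real k + 1) / Gamma (real k - \<gamma> + 1)) *\<^sub>R c k" for k
  define h where "h t = (\<Sum>k=1..n-1. (t - a) powr (real k - \<gamma>) *\<^sub>R v k)" for t
  have hc: "continuous_on {a..b} (\<lambda>t. (t - a) powr (real k - \<gamma>) *\<^sub>R v k)" if "k \<in> {1..n-1}" for k
    using that \<gamma> by (intro continuous_intros continuous_on_powr_diff) auto
  then have hc': "continuous_on {a..b} h" unfolding h_def by (intro continuous_on_sum) auto
  have Jh: "frac_integral a \<gamma> h t = (\<Sum>k=1..n-1. (t - a) ^ k *\<^sub>R c k)" if t: "t \<in> {a..b}" for t
  proof -
    have "frac_integral a \<gamma> h t = (\<Sum>k=1..n-1. frac_integral a \<gamma> (\<lambda>t. (t - a) powr (real k - \<gamma>) *\<^sub>R v k) t)"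
      unfolding h_def using t \<gamma> hc by (intro frac_integral_sum[where b=b]) auto
    also have "\<dots> = (\<Sum>k=1..n-1. (t - a) ^ k *\<^sub>R c k)"
    proof (rule sum.cong[OF refl])
      fix k assume k: "k \<in> {1..n-1}"
      have "real k \<ge> 1" using k by simp
      then have "Gamma (real k - \<gamma> + 1) > 0" "Gamma (real k + 1) > 0"
        using \<gamma> by (intro Gamma_real_pos; linarith)+
      then have G: "Gamma (real k - \<gamma> + 1) \<noteq> 0" "Gamma (real k + 1) \<noteq> 0"
        by (metis less_irrefl)+
      have "frac_integral a \<gamma> (\<lambda>t. (t - a) powr (real k - \<gamma>) *\<^sub>R v k) t =
          (Gamma (real k - \<gamma> + 1) / Gamma (\<gamma> + (real k - \<gamma>) + 1) * (t - a) powr (\<gamma> + (real k - \<gamma>))) *\<^sub>R v k"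
        using k \<gamma> t by (intro frac_integral_powr) auto
      also have "\<dots> = (t - a) ^ k *\<^sub>R c k"
        using G k t by (simp add: v_def powr_realpow')
      finally show "frac_integral a \<gamma> (\<lambda>t. (t - a) powr (real k - \<gamma>) *\<^sub>R v k) t = (t - a) ^ k *\<^sub>R c k" .
    qed
    finally show ?thesis .
  qed
  have Jg: "continuous_on {a..b} (frac_integral a \<beta> g)" by (intro cJ gc \<beta>)
  \<comment> \<open>Injectivity of J^\<gamma> cancels it from the equation J^\<gamma> f = J^\<gamma>
    (J^\<beta> g) + J^\<gamma> h.\<close>
  have fh: "f t - frac_integral a \<beta> g t - h t = 0" if t: "t \<in> {a..b}" for t
  proof (rule frac_integral_eq_0_imp[OF ab _ _ _ t, where \<gamma>=\<gamma>])
    show "continuous_on {a..b} (\<lambda>t. f t - frac_integral a \<beta> g t - h t)"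
      by (intro continuous_intros fc Jg hc')
    fix t assume t: "t \<in> {a..b}"
    have "frac_integral a \<gamma> (\<lambda>t. f t - frac_integral a \<beta> g t - h t) t =
        frac_integral a \<gamma> f t - frac_integral a \<gamma> (frac_integral a \<beta> g) t - frac_integral a \<gamma> h t"
      using t \<gamma> fc Jg hc' by (subst frac_integral_diff[where b=b], (auto intro!: continuous_intros)[4])
        (subst frac_integral_diff[where b=b], auto)
    also have "frac_integral a \<gamma> (frac_integral a \<beta> g) t = frac_integral a (real n) g t"
      using frac_integral_semigroup[OF ab gc _ \<beta>(2) t, of \<gamma>] \<gamma> by (simp add: \<gamma>_def)
    finally show "frac_integral a \<gamma> (\<lambda>t. f t - frac_integral a \<beta> g t - h t) t = 0"
      using c'[OF t] Jh[OF t] by simp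
  qed (use \<gamma> in simp)
  \<comment> \<open>On the interval h equals f - J^\<beta> g, which is of class C^(n-1) since n - 1
    < \<beta>. The number n - 1 of powers equals the number of available derivatives, as
    \<open>powr_sum_coeffs_eq_0\<close> demands.\<close>
  have "\<forall>k\<in>{1..n-1}. v k = 0"
  proof (rule powr_sum_coeffs_eq_0[OF ab \<gamma>,
        where G="\<lambda>j t. higher_deriv_on {a..b} j f t - frac_integral a (\<beta> - real j) g t"])
    fix j t assume jt: "j < n - 1" "t \<in> {a..b}"
    have "(frac_integral a (\<beta> - real j) g has_vector_derivative frac_integral a (\<beta> - real (Suc j)) g t) (at t within {a..b})"
      using frac_integral_has_vector_derivative[OF ab gc _ jt(2), of "\<beta> - real (Suc j)"] jt(1) n by simp
    then show "((\<lambda>t. higher_deriv_on {a..b} j f t - frac_integral a (\<beta> - real j) g t) has_vector_derivative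
        higher_deriv_on {a..b} (Suc j) f t - frac_integral a (\<beta> - real (Suc j)) g t) (at t within {a..b})"
      using jt f unfolding n_def by (intro has_vector_derivative_diff C_space_has_vector_derivative[where k="nat \<lceil>\<beta>\<rceil> - 1"])
  next
    show "continuous_on {a..b} (\<lambda>t. higher_deriv_on {a..b} (n - 1) f t - frac_integral a (\<beta> - real (n - 1)) g t)"
      using f n by (intro continuous_intros cJ gc C_space_continuous[where k="n - 1"]) (auto simp: n_def of_nat_diff)
  next
    fix t assume "t \<in> {a..b}"
    then show "higher_deriv_on {a..b} 0 f t - frac_integral a (\<beta> - real 0) g t = (\<Sum>k=1..n-1. (t - a) powr (real k - \<gamma>) *\<^sub>R v k)"
      using fh[of t] by (simp add: h_def)
  qed
  then have "h t = 0" by (simp add: h_def)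
  then show ?thesis using fh[OF t] by simp
qed

lemma RL_space_not_Nats_iff:
  fixes f :: "real \<Rightarrow> 'x::banach"
  assumes ab: "a < b" and \<beta>: "\<beta> \<notin> \<nat>" "\<beta> \<ge> 0"
  shows "f \<in> RL_space a b \<beta> \<longleftrightarrow>
    (\<exists>g. continuous_on {a..b} g \<and> (\<forall>t\<in>{a..b}. f t = frac_integral a \<beta> g t))"
proof
  have b0: "\<beta> \<noteq> 0" using \<beta> by auto
  {
    assume "f \<in> RL_space a b \<beta>"
    then obtain g where f: "f \<in> C_space a b (nat \<lceil>\<beta>\<rceil> - 1)" and g: "is_continuous_RL_deriv a b \<beta> f g"
      using b0 by (auto simp: RL_space_def)
    show "\<exists>g. continuous_on {a..b} g \<and> (\<forall>t\<in>{a..b}. f t = frac_integral a \<beta> g t)"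
      using eq_frac_integral_RL_deriv[OF ab \<beta> f g] g by (auto simp: is_continuous_RL_deriv_def)
  next
    assume "\<exists>g. continuous_on {a..b} g \<and> (\<forall>t\<in>{a..b}. f t = frac_integral a \<beta> g t)"
    then obtain g where g: "continuous_on {a..b} g" "\<And>t. t \<in> {a..b} \<Longrightarrow> f t = frac_integral a \<beta> g t" by blast
    have "real (nat \<lceil>\<beta>\<rceil> - 1) \<le> \<beta>" using nat_ceiling_not_Nats[OF \<beta>] by (simp add: of_nat_diff)
    then have "f \<in> C_space a b (nat \<lceil>\<beta>\<rceil> - 1)" by (rule frac_integral_C_space(1)[OF ab _ g])
    then show "f \<in> RL_space a b \<beta>"
      using is_continuous_RL_deriv_frac_integral[OF ab \<beta>(2) g] b0 by (auto simp: RL_space_def)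
  }
qed

section \<open>Natural orders: classical differentiability\<close>

lemma is_continuous_RL_deriv_higher_deriv_on:
  fixes f :: "real \<Rightarrow> 'x::banach"
  assumes ab: "a < b" and f: "f \<in> C_space a b n"
  shows "is_continuous_RL_deriv a b (real n) f (higher_deriv_on {a..b} n f)"
proof -
  have n: "n = nat \<lceil>real n\<rceil>" by simp
  show ?thesis
    unfolding is_continuous_RL_deriv_iff[OF ab C_space_continuous_0[OF f] of_nat_0_le_iff n]
    using integral_derivs_test_function[OF _ ab C_space_has_vector_derivative[OF f] C_space_continuous[OF f order_refl]]
      C_space_continuous[OF f order_refl]
    by (simp add: frac_integral_def cong: if_cong)
qed

lemma RL_space_of_nat:
  assumes ab: "a < b"
  shows "RL_space a b (real n) = (C_space a b n :: (real \<Rightarrow> 'x::banach) set)"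
proof (cases n)
  case 0
  then show ?thesis by (simp add: RL_space_def)
next
  case (Suc m)
  \<comment> \<open>The direction with content: the last derivative is given only weakly. du
    Bois-Reymond at order 1 shows that the m-th derivative is J^1 g plus a constant, hence
    classically differentiable with derivative g.\<close>
  have "f \<in> C_space a b (Suc m)"
    if f: "f \<in> C_space a b m" and g: "is_continuous_RL_deriv a b (real (Suc m)) f g" for f g :: "real \<Rightarrow> 'x"
  proof -
    have n: "Suc m = nat \<lceil>real (Suc m)\<rceil>" by linarith
    let ?F = "higher_deriv_on {a..b}"
    note iff = is_continuous_RL_deriv_iff[OF ab C_space_continuous_0[OF f] of_nat_0_le_iff n]
    have gc: "continuous_on {a..b} g" using g iff by blast
    have Fc: "continuous_on {a..b} (?F m f)" using C_space_continuous[OF f] by simp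
    have Jc: "continuous_on {a..b} (frac_integral a 1 g)" by (intro continuous_on_frac_integral ab gc) simp
    have "\<exists>c. \<forall>t\<in>{a..b}. ?F m f t - frac_integral a 1 g t = (\<Sum>k<1. (t - a) ^ k *\<^sub>R c k)"
    proof (rule du_Bois_Reymond[OF ab])
      show "continuous_on {a..b} (\<lambda>t. ?F m f t - frac_integral a 1 g t)" by (intro continuous_intros Fc Jc)
      fix \<phi> assume \<phi>: "test_function a b \<phi>"
      note \<phi>' = test_function_deriv[OF \<phi> ab]
      \<comment> \<open>Of the m + 1 derivatives on \<phi>, m are moved back onto f and one is left,
        which makes g the first weak derivative of the m-th derivative of f.\<close>
      have "integral {a..b} (\<lambda>t. (deriv ^^ m) (deriv \<phi>) t *\<^sub>R f t) = (-1) ^ m *\<^sub>R integral {a..b} (\<lambda>t. deriv \<phi> t *\<^sub>R ?F m f t)"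
        using integral_derivs_test_function[OF \<phi>' ab C_space_has_vector_derivative[OF f] Fc] by simp
      moreover have "integral {a..b} (\<lambda>t. (deriv ^^ m) (deriv \<phi>) t *\<^sub>R f t) = (-1) ^ Suc m *\<^sub>R integral {a..b} (\<lambda>t. \<phi> t *\<^sub>R g t)"
        using g \<phi> unfolding iff by (simp add: frac_integral_def funpow_swap1 cong: if_cong)
      ultimately have "(-1) ^ m *\<^sub>R integral {a..b} (\<lambda>t. deriv \<phi> t *\<^sub>R ?F m f t) = (-1) ^ m *\<^sub>R (- integral {a..b} (\<lambda>t. \<phi> t *\<^sub>R g t))"
        by simp
      then have 1: "integral {a..b} (\<lambda>t. deriv \<phi> t *\<^sub>R ?F m f t) = - integral {a..b} (\<lambda>t. \<phi> t *\<^sub>R g t)"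
        by (subst (asm) scaleR_cancel_left) simp
      have 2: "integral {a..b} (\<lambda>t. deriv \<phi> t *\<^sub>R frac_integral a 1 g t) = - integral {a..b} (\<lambda>t. \<phi> t *\<^sub>R g t)"
        using integral_derivs_test_function_frac_integral[OF \<phi> ab gc, of 1] by simp
      show "integral {a..b} (\<lambda>t. (deriv ^^ 1) \<phi> t *\<^sub>R (?F m f t - frac_integral a 1 g t)) = 0"
        unfolding scaleR_diff_right using 1 2
        by (subst Henstock_Kurzweil_Integration.integral_diff)
          (auto intro!: integrable_continuous_real continuous_intros Fc Jc test_function_continuous[OF \<phi>'])
    qed
    then obtain c where c: "\<And>t. t \<in> {a..b} \<Longrightarrow> ?F m f t = frac_integral a 1 g t + c"
      by (auto simp: algebra_simps)
    have D: "(?F m f has_vector_derivative g t) (at t within {a..b})" if t: "t \<in> {a..b}" for t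
    proof -
      have "(frac_integral a (0 + 1) g has_vector_derivative frac_integral a 0 g t) (at t within {a..b})"
        by (intro frac_integral_has_vector_derivative ab gc t) simp
      then have "((\<lambda>t. frac_integral a 1 g t + c) has_vector_derivative g t + 0) (at t within {a..b})"
        by (intro has_vector_derivative_add has_vector_derivative_const) simp
      then show ?thesis using has_vector_derivative_transform[OF t c] by simp
    qed
    show ?thesis
    proof (rule C_spaceI[OF ab, where F="\<lambda>j. if j \<le> m then ?F j f else g"])
      fix j t assume "j < Suc m" "t \<in> {a..b}"
      then show "((if j \<le> m then ?F j f else g) has_vector_derivative (if Suc j \<le> m then ?F (Suc j) f else g) t) (at t within {a..b})"
        using C_space_has_vector_derivative[OF f, of j t] D[of t] by (cases "j = m") auto
    qed (use gc in auto)
  qed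
  moreover have "nat \<lceil>real (Suc m)\<rceil> - 1 = m" by linarith
  ultimately have "f \<in> RL_space a b (real n) \<longleftrightarrow> f \<in> C_space a b n" for f :: "real \<Rightarrow> 'x"
    using is_continuous_RL_deriv_higher_deriv_on[OF ab, of f n] C_space_antimono[of f a b "Suc m" m] Suc
    unfolding RL_space_def by (auto simp del: of_nat_Suc)
  then show ?thesis by blast
qed

text \<open>For positive n the supremum of the weak derivative in \<open>RL_norm\<close> is exactly
  the top summand of \<open>C_norm\<close>.\<close>

lemma RL_norm_of_nat:
  fixes f :: "real \<Rightarrow> 'x::banach"
  assumes ab: "a < b" and f: "f \<in> C_space a b n"
  shows "RL_norm a b (real n) f = C_norm a b n f"
proof (cases n)
  case 0
  then show ?thesis by (simp add: RL_norm_def)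
next
  case (Suc m)
  have "nat \<lceil>real (Suc m)\<rceil> - 1 = m" by linarith
  moreover have "RL_deriv a b (real n) f t = higher_deriv_on {a..b} n f t" if "t \<in> {a..b}" for t
    using that f by (intro RL_deriv_eq(2)[OF ab _ _ is_continuous_RL_deriv_higher_deriv_on[OF ab f]] C_space_continuous_0) auto
  then have "(SUP t\<in>{a..b}. norm (RL_deriv a b (real n) f t)) = (SUP t\<in>{a..b}. norm (higher_deriv_on {a..b} n f t))"
    by (intro SUP_cong) auto
  ultimately show ?thesis
    using Suc by (simp add: RL_norm_def C_norm_def del: of_nat_Suc higher_deriv_on.simps)
qed

section \<open>Inclusions with norm estimates\<close>

lemma C_norm_le_RL_norm:
  fixes f :: "real \<Rightarrow> 'x::banach"
  assumes ab: "a < b" and \<beta>: "\<beta> \<noteq> 0" and f: "f \<in> RL_space a b \<beta>"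
  shows "C_norm a b (nat \<lceil>\<beta>\<rceil> - 1) f \<le> RL_norm a b \<beta> f"
proof -
  have "\<exists>g. is_continuous_RL_deriv a b \<beta> f g" using f \<beta> by (simp add: RL_space_def)
  then have "is_continuous_RL_deriv a b \<beta> f (RL_deriv a b \<beta> f)" unfolding RL_deriv_def by (rule someI_ex)
  then have "continuous_on {a..b} (RL_deriv a b \<beta> f)" by (simp add: is_continuous_RL_deriv_def)
  then show ?thesis using SUP_norm_nonneg[of a b "RL_deriv a b \<beta> f"] ab \<beta> by (simp add: RL_norm_def)
qed

lemma RL_space_not_Nats_mono:
  assumes ab: "a < b" and "\<alpha> \<notin> \<nat>" "\<beta> \<notin> \<nat>" "0 \<le> \<alpha>" "\<alpha> < \<beta>"
  shows "(RL_space a b \<beta> :: (real \<Rightarrow> 'x::banach) set) \<subseteq> RL_space a b \<alpha>"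
    and "\<exists>M>0. \<forall>f \<in> (RL_space a b \<beta> :: (real \<Rightarrow> 'x) set). RL_norm a b \<alpha> f \<le> M * RL_norm a b \<beta> f"
proof -
  \<comment> \<open>The supremum-norm bound of J^(\<beta>-\<alpha>) on continuous functions.\<close>
  define C where "C = (b - a) powr (\<beta> - \<alpha>) / Gamma (\<beta> - \<alpha> + 1)"
  have C: "C \<ge> 0" using assms Gamma_real_pos[of "\<beta> - \<alpha> + 1"] by (simp add: C_def)
  have \<beta>: "\<beta> \<ge> 0" "\<beta> \<noteq> 0" "\<alpha> \<noteq> 0" using assms by auto
  have main: "f \<in> RL_space a b \<alpha> \<and> RL_norm a b \<alpha> f \<le> (1 + C) * RL_norm a b \<beta> f"
    if f: "f \<in> RL_space a b \<beta>" for f :: "real \<Rightarrow> 'x"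
  proof -
    define g where "g = RL_deriv a b \<beta> f"
    have fC: "f \<in> C_space a b (nat \<lceil>\<beta>\<rceil> - 1)" and ex: "\<exists>g. is_continuous_RL_deriv a b \<beta> f g"
      using f \<beta> by (auto simp: RL_space_def)
    have fc: "continuous_on {a..b} f" using fC by (rule C_space_continuous_0)
    have g: "is_continuous_RL_deriv a b \<beta> f g"
      unfolding g_def RL_deriv_def using ex by (rule someI_ex)
    then have gc: "continuous_on {a..b} g" by (simp add: is_continuous_RL_deriv_def)
    \<comment> \<open>From f = J^\<alpha> (J^(\<beta>-\<alpha>) g) this function is the
      Riemann-Liouville derivative of f of order \<alpha>, so C bounds its norm in terms of
      g.\<close>
    let ?h = "frac_integral a (\<beta> - \<alpha>) g"
    have hc: "continuous_on {a..b} ?h" using assms by (intro continuous_on_frac_integral gc) auto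
    have fh: "f t = frac_integral a \<alpha> ?h t" if t: "t \<in> {a..b}" for t
      using eq_frac_integral_RL_deriv[OF ab assms(3) \<beta>(1) fC g t]
        frac_integral_semigroup[OF ab gc assms(4) _ t, of "\<beta> - \<alpha>"] assms(5) by simp
    then have fA: "f \<in> RL_space a b \<alpha>"
      unfolding RL_space_not_Nats_iff[OF ab assms(2,4)] using hc by blast
    have D: "RL_deriv a b \<alpha> f t = ?h t" if "t \<in> {a..b}" for t
      using that by (intro RL_deriv_eq(2)[OF ab fc assms(4)] is_continuous_RL_deriv_frac_integral[OF ab assms(4) hc fh])
    let ?B = "SUP t\<in>{a..b}. norm (g t)"
    have B: "?B \<ge> 0" using ab by (intro SUP_norm_nonneg gc) simp
    have "(SUP t\<in>{a..b}. norm (RL_deriv a b \<alpha> f t)) \<le> ?B * C"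
    proof (rule cSUP_least)
      fix t assume t: "t \<in> {a..b}"
      show "norm (RL_deriv a b \<alpha> f t) \<le> ?B * C"
        unfolding D[OF t] C_def using assms(5)
        by (intro norm_frac_integral_le'[OF gc _ t]) (auto intro: norm_le_SUP[OF gc])
    qed (use ab in auto)
    moreover have cn: "C_norm a b (nat \<lceil>\<alpha>\<rceil> - 1) f \<le> C_norm a b (nat \<lceil>\<beta>\<rceil> - 1) f"
      using ab assms(5) fC by (intro C_norm_mono) (auto intro!: diff_le_mono nat_mono ceiling_mono)
    moreover have "0 \<le> C_norm a b (nat \<lceil>\<beta>\<rceil> - 1) f"
      unfolding C_norm_def using ab by (intro sum_nonneg SUP_norm_nonneg C_space_continuous[OF fC]) auto
    then have "0 \<le> C * C_norm a b (nat \<lceil>\<beta>\<rceil> - 1) f" using C by simp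
    \<comment> \<open>In M = 1 + C the summand 1 accounts for the classical derivatives and C for
      the fractional one.\<close>
    ultimately have "C_norm a b (nat \<lceil>\<alpha>\<rceil> - 1) f + (SUP t\<in>{a..b}. norm (RL_deriv a b \<alpha> f t))
        \<le> (1 + C) * (C_norm a b (nat \<lceil>\<beta>\<rceil> - 1) f + ?B)"
      using B by (simp add: algebra_simps)
    then have "RL_norm a b \<alpha> f \<le> (1 + C) * RL_norm a b \<beta> f"
      using \<beta> by (simp add: RL_norm_def g_def)
    with fA show ?thesis by blast
  qed
  show "(RL_space a b \<beta> :: (real \<Rightarrow> 'x) set) \<subseteq> RL_space a b \<alpha>" using main by blast
  show "\<exists>M>0. \<forall>f \<in> (RL_space a b \<beta> :: (real \<Rightarrow> 'x) set). RL_norm a b \<alpha> f \<le> M * RL_norm a b \<beta> f"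
    using main C by (intro exI[of _ "1 + C"]) auto
qed

text \<open>For non-natural \<beta>, m < \<beta> gives m at most the ceiling of \<beta> minus 1. The
  whole C^m norm is then already part of the RL^\<beta> norm, and M = 1 suffices; for natural
  \<beta> the norms are C^n and C^m norms.\<close>

lemma RL_space_of_nat_mono:
  assumes ab: "a < b" and "real m < \<beta>"
  shows "(RL_space a b \<beta> :: (real \<Rightarrow> 'x::banach) set) \<subseteq> RL_space a b (real m)"
    and "\<exists>M>0. \<forall>f \<in> (RL_space a b \<beta> :: (real \<Rightarrow> 'x) set). RL_norm a b (real m) f \<le> M * RL_norm a b \<beta> f"
proof -
  have \<beta>: "\<beta> \<noteq> 0" using assms(2) by auto
  have main: "f \<in> C_space a b m \<and> C_norm a b m f \<le> RL_norm a b \<beta> f"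
    if f: "f \<in> RL_space a b \<beta>" for f :: "real \<Rightarrow> 'x"
  proof (cases "\<beta> \<in> \<nat>")
    case True
    then obtain n where n: "\<beta> = real n" by (auto elim: Nats_cases)
    then have "f \<in> C_space a b n" using f RL_space_of_nat[OF ab] by auto
    then show ?thesis
      using assms(2) ab C_space_antimono[of f a b n m] C_norm_mono[of a b f n m] by (simp add: n RL_norm_of_nat)
  next
    case False
    have "f \<in> C_space a b (nat \<lceil>\<beta>\<rceil> - 1)" using f \<beta> by (simp add: RL_space_def)
    moreover have "m \<le> nat \<lceil>\<beta>\<rceil> - 1"
      using nat_ceiling_not_Nats[OF False] assms(2) by linarith
    ultimately show ?thesis
      using C_norm_le_RL_norm[OF ab \<beta> f] C_norm_mono[of a b f "nat \<lceil>\<beta>\<rceil> - 1" m] C_space_antimono[of f a b "nat \<lceil>\<beta>\<rceil> - 1" m] ab by auto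
  qed
  show "(RL_space a b \<beta> :: (real \<Rightarrow> 'x) set) \<subseteq> RL_space a b (real m)"
    using main by (auto simp: RL_space_of_nat[OF ab])
  show "\<exists>M>0. \<forall>f \<in> (RL_space a b \<beta> :: (real \<Rightarrow> 'x) set). RL_norm a b (real m) f \<le> M * RL_norm a b \<beta> f"
    using main by (intro exI[of _ 1]) (auto simp: RL_norm_of_nat[OF ab])
qed

section \<open>Strictness and the failing inclusion\<close>

lemma RL_space_neq:
  fixes x :: "'x::banach"
  assumes ab: "a < b" and "x \<noteq> 0" and \<alpha>\<beta>: "0 \<le> \<alpha>" "\<alpha> < \<beta>" and disj: "\<alpha> \<in> \<nat> \<or> \<beta> \<notin> \<nat>"
  shows "(RL_space a b \<beta> :: (real \<Rightarrow> 'x) set) \<noteq> RL_space a b \<alpha>"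
proof -
  \<comment> \<open>Used with \<gamma> = \<alpha> when \<alpha> is not natural, and with the
    intermediate \<gamma> chosen below when only \<beta> is not natural.\<close>
  have growth: "frac_integral a \<gamma> (\<lambda>_. x) \<notin> RL_space a b \<beta>" if "\<beta> \<notin> \<nat>" "0 \<le> \<gamma>" "\<gamma> < \<beta>" for \<gamma>
  proof
    have \<beta>: "0 \<le> \<beta>" using \<alpha>\<beta> by simp
    assume "frac_integral a \<gamma> (\<lambda>_. x) \<in> RL_space a b \<beta>"
    then obtain g where "continuous_on {a..b} g" "\<And>t. t \<in> {a..b} \<Longrightarrow> frac_integral a \<gamma> (\<lambda>_. x) t = frac_integral a \<beta> g t"
      unfolding RL_space_not_Nats_iff[OF ab \<open>\<beta> \<notin> \<nat>\<close> \<beta>] by blast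
    from frac_integral_const_eq_imp_0[OF ab this(1) that(2,3) this(2)] show False using \<open>x \<noteq> 0\<close> by simp
  qed
  show ?thesis
  proof (cases "\<alpha> \<in> \<nat>")
    case False
    have "frac_integral a \<alpha> (\<lambda>_. x) \<in> RL_space a b \<alpha>"
      unfolding RL_space_not_Nats_iff[OF ab False \<alpha>\<beta>(1)] by (intro exI[of _ "\<lambda>_. x"]) auto
    then show ?thesis using growth[of \<alpha>] False disj \<alpha>\<beta> by blast
  next
    case True
    then obtain m where m: "\<alpha> = real m" by (auto elim: Nats_cases)
    \<comment> \<open>The bound m < \<gamma> puts J^\<gamma> x into C^m with m-th derivative
      vanishing at a; \<gamma> < m + 1 excludes it from C^(m+1), and \<gamma> < \<beta> makes
      \<open>growth\<close> applicable.\<close>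
    obtain \<gamma> where \<gamma>: "real m < \<gamma>" "\<gamma> < min \<beta> (real m + 1)"
      using dense[of "real m" "min \<beta> (real m + 1)"] \<alpha>\<beta> m by auto
    let ?f = "frac_integral a \<gamma> (\<lambda>_. x)"
    have c: "continuous_on {a..b} (\<lambda>_. x)" by simp
    have f: "?f \<in> C_space a b m"
      using \<gamma> by (intro frac_integral_C_space(1)[OF ab _ c]) auto
    have F: "higher_deriv_on {a..b} m ?f t = frac_integral a (\<gamma> - real m) (\<lambda>_. x) t" if "t \<in> {a..b}" for t
      using \<gamma> that by (intro frac_integral_C_space(2)[OF ab _ c, where k=m]) auto
    have "?f \<notin> RL_space a b \<beta>"
    proof (cases "\<beta> \<in> \<nat>")
      case False
      then show ?thesis using growth \<gamma> by auto
    next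
      case True
      then obtain n where n: "\<beta> = real n" by (auto elim: Nats_cases)
      have mn: "Suc m \<le> n" using \<alpha>\<beta> m n by simp
      show ?thesis
      proof
        assume "?f \<in> RL_space a b \<beta>"
        then have f': "?f \<in> C_space a b (Suc m)"
          using mn C_space_antimono unfolding n RL_space_of_nat[OF ab] by blast
        define g where "g = higher_deriv_on {a..b} (Suc m) ?f"
        have gc: "continuous_on {a..b} g" unfolding g_def by (rule C_space_continuous[OF f']) simp
        \<comment> \<open>If the m-th derivative were C^1, it would be J^1 of its derivative g, as
          it vanishes at a. The order \<gamma> - m on the left is below 1, so x would have to be
          0.\<close>
        have "frac_integral a (\<gamma> - real m) (\<lambda>_. x) t = frac_integral a 1 g t" if t: "t \<in> {a..b}" for t
        proof -
          have "(g has_integral higher_deriv_on {a..b} m ?f t - higher_deriv_on {a..b} m ?f a) {a..t}"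
          proof (rule fundamental_theorem_of_calculus)
            fix s assume "s \<in> {a..t}"
            then have "(higher_deriv_on {a..b} m ?f has_vector_derivative g s) (at s within {a..b})"
              unfolding g_def using t by (intro C_space_has_vector_derivative[OF f']) auto
            then show "(higher_deriv_on {a..b} m ?f has_vector_derivative g s) (at s within {a..t})"
              by (rule has_vector_derivative_within_subset) (use t in auto)
          qed (use t in auto)
          then show ?thesis
            using F[OF t] F[of a] ab \<gamma> by (simp add: frac_integral_1 integral_unique frac_integral_left)
        qed
        from frac_integral_const_eq_imp_0[OF ab gc _ _ this] show False using \<gamma> \<open>x \<noteq> 0\<close> by simp
      qed
    qed
    then show ?thesis using f m by (auto simp: RL_space_of_nat[OF ab])
  qed
qed

lemma RL_space_of_nat_not_subset:
  fixes x :: "'x::banach"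
  assumes ab: "a < b" and x: "x \<noteq> 0" and \<alpha>: "\<alpha> \<notin> \<nat>" "0 \<le> \<alpha>"
  shows "\<not> (RL_space a b (real n) :: (real \<Rightarrow> 'x) set) \<subseteq> RL_space a b \<alpha>"
proof
  assume sub: "(RL_space a b (real n) :: (real \<Rightarrow> 'x) set) \<subseteq> RL_space a b \<alpha>"
  have "(\<lambda>_. x) \<in> C_space a b n"
    by (rule C_spaceI[OF ab, where F="\<lambda>j _. if j = 0 then x else 0"]) auto
  then have "(\<lambda>_. x) \<in> RL_space a b \<alpha>" using sub RL_space_of_nat[OF ab] by blast
  then obtain g where "\<And>t. t \<in> {a..b} \<Longrightarrow> x = frac_integral a \<alpha> g t"
    by (auto simp: RL_space_not_Nats_iff[OF ab \<alpha>])
  then have "x = frac_integral a \<alpha> g a" using ab by auto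
  then show False using x nat_ceiling_not_Nats(5)[OF \<alpha>] by (simp add: frac_integral_left)
qed

theorem theorem13:
  fixes t0 t1 \<alpha> \<beta> :: real
  assumes "(UNIV :: 'x::banach set) \<noteq> {0}"
    and "t0 < t1" and "0 \<le> \<alpha>" and "\<alpha> < \<beta>"
  shows "(\<alpha> \<in> \<nat> \<or> (\<alpha> \<notin> \<nat> \<and> \<beta> \<notin> \<nat>) \<longrightarrow>
            (RL_space t0 t1 \<beta> :: (real \<Rightarrow> 'x) set) \<subset> RL_space t0 t1 \<alpha> \<and>
            (\<exists>M>0. \<forall>f \<in> (RL_space t0 t1 \<beta> :: (real \<Rightarrow> 'x) set).
               RL_norm t0 t1 \<alpha> f \<le> M * RL_norm t0 t1 \<beta> f)) \<and>
         (\<alpha> \<notin> \<nat> \<and> \<beta> \<in> \<nat> \<longrightarrow>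
            \<not> (RL_space t0 t1 \<beta> :: (real \<Rightarrow> 'x) set) \<subseteq> RL_space t0 t1 \<alpha>)"
proof (intro conjI impI; (elim conjE)?)
  obtain x :: 'x where x: "x \<noteq> 0" using assms(1) by blast
  assume *: "\<alpha> \<in> \<nat> \<or> (\<alpha> \<notin> \<nat> \<and> \<beta> \<notin> \<nat>)"
  have "(RL_space t0 t1 \<beta> :: (real \<Rightarrow> 'x) set) \<subseteq> RL_space t0 t1 \<alpha> \<and>
      (\<exists>M>0. \<forall>f \<in> (RL_space t0 t1 \<beta> :: (real \<Rightarrow> 'x) set). RL_norm t0 t1 \<alpha> f \<le> M * RL_norm t0 t1 \<beta> f)"
  proof (cases "\<alpha> \<in> \<nat>")
    case True
    then obtain m where "\<alpha> = real m" by (auto elim: Nats_cases)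
    then show ?thesis using RL_space_of_nat_mono[OF assms(2)] assms(4) by blast
  next
    case False
    then show ?thesis using RL_space_not_Nats_mono[OF assms(2) False _ assms(3,4)] * by blast
  qed
  moreover have "(RL_space t0 t1 \<beta> :: (real \<Rightarrow> 'x) set) \<noteq> RL_space t0 t1 \<alpha>"
    using RL_space_neq[OF assms(2) x assms(3,4)] * by blast
  ultimately show "(RL_space t0 t1 \<beta> :: (real \<Rightarrow> 'x) set) \<subset> RL_space t0 t1 \<alpha>"
    "\<exists>M>0. \<forall>f \<in> (RL_space t0 t1 \<beta> :: (real \<Rightarrow> 'x) set). RL_norm t0 t1 \<alpha> f \<le> M * RL_norm t0 t1 \<beta> f" by auto
next
  obtain x :: 'x where x: "x \<noteq> 0" using assms(1) by blast
  assume "\<alpha> \<notin> \<nat>" "\<beta> \<in> \<nat>"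
  then show "\<not> (RL_space t0 t1 \<beta> :: (real \<Rightarrow> 'x) set) \<subseteq> RL_space t0 t1 \<alpha>"
    using RL_space_of_nat_not_subset[OF assms(2) x _ assms(3)] by (auto elim: Nats_cases)
qed

end
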